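(* For any $x,y\in\mathbb R$, $$\lim_{n\to\infty}M_n^{\mathrm{uni}}\Bigl\{\lambda\in\mathcal P_n:\tfrac{\pi}{\sqrt{6n}}\ell_o(\lambda)-\alpha(n)\le x,\ \tfrac{\pi}{\sqrt{6n}}\ell_e(\lambda)-\alpha(n)\le y\Bigr\}=\operatorname{Erfc}(\mathrm e^{-x})\,\mathrm e^{-\mathrm e^{-2y}},$$ where $$\operatorname{Erfc}(u)=\frac2{\sqrt\pi}\int_u^\infty\mathrm e^{-z^2}\,dz\qquad\text{and}\qquad\alpha(n)=\tfrac14\log n-\tfrac12\log\tfrac{2\pi}{\sqrt6}.$$
   Context: $\mathcal P_n$ is the set of integer partitions of $n$ and $M_n^{\mathrm{uni}}$ is the uniform probability measure on $\mathcal P_n$. For a partition $\lambda$, $C_k(\lambda)$ denotes the number of its parts equal to $k$, $k\ge1$; $\ell_o(\lambda)=\sum_{k\text{ odd}}C_k(\lambda)$ is the number of odd parts and $\ell_e(\lambda)=\sum_{k\text{ even}}C_k(\lambda)$ is the number of even (positive) parts, counted with multiplicity. *)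

theory Defs
  imports "HOL-Probability.Probability" "HOL-Library.Multiset"
begin

text \<open>An integer partition is the multiset of its (positive) parts, so the multiplicity
  \<open>C\<^sub>k(\<lambda>)\<close> of the part \<open>k\<close> is \<^term>\<open>count lam k\<close>.\<close>

definition partitions :: "nat \<Rightarrow> nat multiset set" where
  "partitions n = {lam. 0 \<notin># lam \<and> sum_mset lam = n}"

lemma size_le_sum_mset: "0 \<notin># lam \<Longrightarrow> size lam \<le> sum_mset (lam :: nat multiset)"
  by (induction lam) auto

text \<open>\<^const>\<open>pmf_of_set\<close> is the uniform distribution only on finite nonempty sets.\<close>

lemma finite_partitions: "finite (partitions n)"
proof (rule finite_subset)
  show "partitions n \<subseteq> mset ` {xs. set xs \<subseteq> {..n} \<and> length xs \<le> n}"
  proof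
    fix lam assume lam: "lam \<in> partitions n"
    obtain xs where xs: "mset xs = lam"
      using ex_mset by blast
    have "x \<le> n" if "x \<in> set xs" for x
      using that lam xs sum_mset.remove[of x lam] by (auto simp: partitions_def)
    moreover have "length xs \<le> n"
      using size_le_sum_mset[of lam] lam xs by (auto simp: partitions_def)
    ultimately show "lam \<in> mset ` {xs. set xs \<subseteq> {..n} \<and> length xs \<le> n}"
      using xs by auto
  qed
  show "finite (mset ` {xs. set xs \<subseteq> {..n} \<and> length xs \<le> n})"
    by (intro finite_imageI finite_lists_length_le) simp
qed

lemma partitions_nonempty: "partitions n \<noteq> {}"
proof -
  have "replicate_mset n 1 \<in> partitions n"
    by (auto simp: partitions_def sum_mset_replicate_mset)
  then show ?thesis by blast
qed

definition M_uni :: "nat \<Rightarrow> nat multiset pmf" where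
  "M_uni n = pmf_of_set (partitions n)"

definition odd_parts :: "nat multiset \<Rightarrow> nat" where
  "odd_parts lam = (\<Sum>k | k \<in># lam \<and> odd k. count lam k)"

definition even_parts :: "nat multiset \<Rightarrow> nat" where
  "even_parts lam = (\<Sum>k | k \<in># lam \<and> even k. count lam k)"

definition Erfc :: "real \<Rightarrow> real" where
  "Erfc u = 2 / sqrt pi * (LBINT z:{u..}. exp (- z\<^sup>2))"

definition alpha :: "nat \<Rightarrow> real" where
  "alpha n = 1 / 4 * ln (real n) - 1 / 2 * ln (2 * pi / sqrt 6)"

end

theory Submission imports Defs "HOL-Real_Asymp.Real_Asymp" begin

text \<open>
  The generating function of the partitions with \<open>j\<close> odd parts and at most \<open>m\<close> even parts is
  \<open>q ^ j\<close> divided by \<open>\<Prod>k\<le>j. 1 - q ^ (2 * k)\<close> and by \<open>\<Prod>k\<le>m. 1 - q ^ (2 * k)\<close>. Hence the number of such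
  partitions of \<open>n\<close> is the coefficient at \<open>M = (n - j) / 2\<close> of \<open>1 / ((\<Prod>k\<le>j. 1 - q ^ k) * (\<Prod>k\<le>m. 1 - q ^ k))\<close>
  if \<open>n - j\<close> is even and nonnegative, and zero otherwise (lemma \<open>card_partitions_odd_even\<close> with
  \<open>count_pairs_sums\<close>).

  Put \<open>s = 2 * pi / sqrt (6 * n)\<close> and tilt by \<open>q = exp (- s)\<close>. The coefficient is then an explicit factor times
  the probability that \<open>\<Sum>k\<le>j. k * G k + \<Sum>k\<le>m. k * G' k = M\<close>, where the \<open>G k\<close> and \<open>G' k\<close> are
  independent geometric variables with ratios \<open>exp (- s * k)\<close>. This sum has standard deviation of order
  \<open>s powr (- 3 / 2)\<close>, and for the relevant \<open>j\<close> and \<open>m\<close> its mean differs from \<open>M\<close> by less than that order. By the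
  local limit theorem \<open>local_limit\<close> the probability is asymptotically \<open>K * s powr (3 / 2)\<close> with a constant \<open>K\<close>
  independent of \<open>j\<close> and \<open>m\<close>, and \<open>local_prob_le_bound\<close> bounds it by a multiple of \<open>s powr (3 / 2)\<close> for all \<open>j\<close>.

  The explicit factor depends on \<open>j\<close> and \<open>m\<close> only through \<open>exp (- s * j / 2)\<close> and the tail products
  \<open>\<Prod>k\<in>{j<..n}. 1 - exp (- s * k)\<close> and \<open>\<Prod>k\<in>{m<..n}. 1 - exp (- s * k)\<close>. In terms of
  \<open>z = s powr (- 1 / 2) * exp (- s * j / 2)\<close>, which is \<open>exp (- u)\<close> for the normalised number \<open>u\<close> of odd parts,
  the first tail product tends to \<open>exp (- z\<^sup>2)\<close> (lemma \<open>tail_prod_limit\<close>), and the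
  remaining factor is proportional to the distance between consecutive values of \<open>z\<close>. So the sum over \<open>j\<close> is
  the integral of a step function of \<open>z\<close>, which converges by dominated convergence to
  a multiple of \<open>exp (- exp (- 2 * y))\<close> times the integral of \<open>exp (- z\<^sup>2)\<close> over \<open>z \<ge> exp (- x)\<close>
  (lemma \<open>step_fun_limit\<close>). Dividing by the same expression for all partitions removes every unknown
  constant, in particular \<open>K\<close>, so the asymptotics of the number of partitions is never needed.
\<close>

section \<open>Counting partitions by odd and even parts\<close>

text \<open>Multisets of \<open>j\<close> natural numbers with sum \<open>N\<close>. The number \<open>0\<close> is allowed as an element, so these are the
partitions of \<open>N\<close> into at most \<open>j\<close> parts, padded with zeros.\<close>

definition msets :: "nat \<Rightarrow> nat \<Rightarrow> nat multiset set" where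
  "msets j N = {A. size A = j \<and> sum_mset A = N}"

definition count_msets :: "nat \<Rightarrow> nat \<Rightarrow> nat" where
  "count_msets j N = card (msets j N)"

lemma finite_msets: "finite (msets j N)"
proof (rule finite_subset)
  show "msets j N \<subseteq> mset ` {xs. set xs \<subseteq> {..N} \<and> length xs = j}"
  proof
    fix A assume A: "A \<in> msets j N"
    obtain xs where xs: "mset xs = A" using ex_mset by blast
    have "x \<le> N" if "x \<in> set xs" for x
      using that A xs sum_mset.remove[of x A] by (auto simp: msets_def)
    then show "A \<in> mset ` {xs. set xs \<subseteq> {..N} \<and> length xs = j}"
      using xs A by (auto simp: msets_def)
  qed
  show "finite (mset ` {xs. set xs \<subseteq> {..N} \<and> length xs = j})"
    by (intro finite_imageI finite_lists_length_eq) simp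
qed

lemma count_msets_0: "count_msets 0 N = (if N = 0 then 1 else 0)"
proof -
  have "msets 0 N = (if N = 0 then {{#}} else {})"
    by (auto simp: msets_def)
  then show ?thesis by (simp add: count_msets_def)
qed

lemma sum_image_Suc: "sum_mset (image_mset Suc A) = sum_mset A + size A"
  by (induction A) auto

text \<open>A multiset of size \<open>j + 1\<close> either contains \<open>0\<close>, which can be removed, or all its elements are
positive and can be lowered by one. This recursion is also that of the partitions into parts of size
at most \<open>j + 1\<close>, which is why the product formula below needs no conjugation of diagrams.\<close>

lemma count_msets_Suc:
  "count_msets (Suc j) N = count_msets j N + (if Suc j \<le> N then count_msets (Suc j) (N - Suc j) else 0)"
proof -
  let ?S = "if Suc j \<le> N then msets (Suc j) (N - Suc j) else {}"
  have eq: "msets (Suc j) N = add_mset 0 ` msets j N \<union> image_mset Suc ` ?S" (is "?L = ?R1 \<union> ?R2")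
  proof
    show "?L \<subseteq> ?R1 \<union> ?R2"
    proof
      fix A assume A: "A \<in> ?L"
      show "A \<in> ?R1 \<union> ?R2"
      proof (cases "0 \<in># A")
        case True
        then obtain B where "A = add_mset 0 B" by (metis insert_DiffM)
        with A show ?thesis by (auto simp: msets_def)
      next
        case False
        define B where "B = image_mset (\<lambda>x. x - 1) A"
        have "image_mset Suc B = image_mset id A"
          unfolding B_def image_mset.compositionality o_def
          using False by (intro image_mset_cong) (auto, metis Suc_pred not_gr_zero)
        then have AB: "A = image_mset Suc B" by simp
        have "sum_mset B + Suc j = N" "size B = Suc j"
          using A AB sum_image_Suc[of B] by (auto simp: msets_def)
        then have "B \<in> ?S" by (auto simp: msets_def)
        then show ?thesis using AB by blast
      qed
    qed
    show "?R1 \<union> ?R2 \<subseteq> ?L"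
      by (auto simp: msets_def sum_image_Suc)
  qed
  have "0 \<in># A" if "A \<in> ?R1" for A using that by auto
  moreover have "0 \<notin># A" if "A \<in> ?R2" for A using that by auto
  ultimately have disj: "?R1 \<inter> ?R2 = {}" by blast
  have "card ?L = card ?R1 + card ?R2"
    unfolding eq by (rule card_Un_disjoint) (auto simp: finite_msets disj)
  also have "card ?R1 = count_msets j N"
    unfolding count_msets_def by (rule card_image) (auto simp: inj_on_def)
  also have "card ?R2 = card ?S"
    by (rule card_image, rule inj_on_subset[OF multiset.inj_map]) simp_all
  finally show ?thesis by (cases "Suc j \<le> N") (simp_all add: count_msets_def)
qed

lemma count_msets_summable_real:
  fixes r :: real assumes "0 \<le> r" "r < 1"
  shows "summable (\<lambda>N. real (count_msets j N) * r ^ N)"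
proof (induction j)
  case 0
  show ?case
    by (rule summable_finite[of "{0}"]) (auto simp: count_msets_0)
next
  case (Suc j)
  let ?f = "\<lambda>j N. real (count_msets j N) * r ^ N"
  define B where "B = suminf (?f j) / (1 - r ^ Suc j)"
  have r1: "r ^ Suc j < 1" using assms by (metis power_Suc_less_one power_0_Suc less_eq_real_def zero_less_one)
  have nn: "0 \<le> ?f j N" for j N using assms by simp
  \<comment> \<open>The recursion bounds the partial sums: \<open>S \<le> suminf (?f j) + r ^ Suc j * S\<close>.\<close>
  have "sum (?f (Suc j)) {..<L} \<le> B" for L
  proof -
    have "sum (?f (Suc j)) {..<L} = sum (?f j) {..<L} +
       (\<Sum>N<L. (if Suc j \<le> N then count_msets (Suc j) (N - Suc j) else 0) * r ^ N)"
      by (subst count_msets_Suc) (simp add: sum.distrib algebra_simps)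
    also have "(\<Sum>N<L. (if Suc j \<le> N then count_msets (Suc j) (N - Suc j) else 0) * r ^ N)
       = (\<Sum>N\<in>{Suc j..<L}. r ^ Suc j * ?f (Suc j) (N - Suc j))"
      by (rule sum.mono_neutral_cong_right) (auto simp: algebra_simps simp flip: power_add simp del: power_Suc)
    also have "\<dots> = (\<Sum>N<L - Suc j. r ^ Suc j * ?f (Suc j) N)"
      by (rule sum.reindex_bij_witness[of _ "\<lambda>N. N + Suc j" "\<lambda>N. N - Suc j"]) auto
    also have "\<dots> = r ^ Suc j * sum (?f (Suc j)) {..<L - Suc j}"
      by (simp add: sum_distrib_left)
    also have "\<dots> \<le> r ^ Suc j * sum (?f (Suc j)) {..<L}"
      using assms nn by (intro mult_left_mono sum_mono2) auto
    also have "sum (?f j) {..<L} \<le> suminf (?f j)"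
      by (rule sum_le_suminf[OF Suc]) (use nn in auto)
    finally have "sum (?f (Suc j)) {..<L} * (1 - r ^ Suc j) \<le> suminf (?f j)"
      by (simp add: algebra_simps)
    then show ?thesis using r1 by (simp add: B_def pos_le_divide_eq)
  qed
  then show ?case
    by (intro summableI_nonneg_bounded[where x = B]) (use nn in auto)
qed

lemma count_msets_summable_norm:
  fixes z :: complex assumes "norm z < 1"
  shows "summable (\<lambda>N. norm (of_nat (count_msets j N) * z ^ N))"
  using count_msets_summable_real[of "norm z" j] assms by (simp add: norm_mult norm_power)

lemma count_msets_sums:
  fixes z :: complex assumes z: "norm z < 1"
  shows "(\<lambda>N. of_nat (count_msets j N) * z ^ N) sums (\<Prod>k\<in>{1..j}. 1 / (1 - z ^ k))"
proof (induction j)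
  case 0
  have "(\<lambda>N. of_nat (count_msets 0 N) * z ^ N) = (\<lambda>N. if N \<in> {0} then 1 else 0)"
    by (auto simp: count_msets_0)
  then show ?case
    using sums_If_finite_set[of "{0}" "\<lambda>N. 1 :: complex"] by simp
next
  case (Suc j)
  let ?f = "\<lambda>j N. of_nat (count_msets j N) * z ^ N"
  have "summable (?f (Suc j))"
    by (rule summable_norm_cancel[OF count_msets_summable_norm[OF z]])
  then obtain S where S: "?f (Suc j) sums S" by (auto simp: summable_def)
  have "(\<lambda>N. z ^ Suc j * ?f (Suc j) N) sums (z ^ Suc j * S)"
    by (rule sums_mult[OF S])
  then have "(\<lambda>N. if N < Suc j then 0 else z ^ Suc j * ?f (Suc j) (N - Suc j)) sums (z ^ Suc j * S)"
    using sums_iff_shift'[of "\<lambda>N. if N < Suc j then 0 else z ^ Suc j * ?f (Suc j) (N - Suc j)" "Suc j" "z ^ Suc j * S"]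
    by simp
  from sums_add[OF Suc this]
  have "(\<lambda>N. ?f j N + (if N < Suc j then 0 else z ^ Suc j * ?f (Suc j) (N - Suc j))) sums
     ((\<Prod>k\<in>{1..j}. 1 / (1 - z ^ k)) + z ^ Suc j * S)" .
  also have "(\<lambda>N. ?f j N + (if N < Suc j then 0 else z ^ Suc j * ?f (Suc j) (N - Suc j))) = ?f (Suc j)"
  proof
    fix N
    show "?f j N + (if N < Suc j then 0 else z ^ Suc j * ?f (Suc j) (N - Suc j)) = ?f (Suc j) N"
      by (subst count_msets_Suc[of j N]) (auto simp: algebra_simps simp flip: power_add simp del: power_Suc)
  qed
  finally have "S = (\<Prod>k\<in>{1..j}. 1 / (1 - z ^ k)) + z ^ Suc j * S"
    using S sums_unique2 by blast
  then have "S * (1 - z ^ Suc j) = (\<Prod>k\<in>{1..j}. 1 / (1 - z ^ k))" by (simp add: algebra_simps)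
  moreover have "1 - z ^ Suc j \<noteq> 0"
  proof
    assume "1 - z ^ Suc j = 0"
    then have "norm z ^ Suc j = 1" by (metis eq_iff_diff_eq_0 norm_one norm_power)
    then show False using z power_Suc_less_one[of "norm z" j]
      by (metis norm_ge_zero less_irrefl order_le_less power_0_Suc zero_neq_one)
  qed
  ultimately have "S = (\<Prod>k\<in>{1..Suc j}. 1 / (1 - z ^ k))"
    by (simp add: field_simps)
  then show ?case using S by simp
qed

text \<open>The number of pairs of such multisets, of sizes \<open>j\<close> and \<open>m\<close>, with total sum \<open>N\<close>.\<close>

definition count_pairs :: "nat \<Rightarrow> nat \<Rightarrow> nat \<Rightarrow> nat" where
  "count_pairs j m N = (\<Sum>a\<le>N. count_msets j a * count_msets m (N - a))"

lemma count_pairs_sums: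
  fixes z :: complex assumes z: "norm z < 1"
  shows "(\<lambda>N. of_nat (count_pairs j m N) * z ^ N) sums
    ((\<Prod>k\<in>{1..j}. 1 / (1 - z ^ k)) * (\<Prod>k\<in>{1..m}. 1 / (1 - z ^ k)))"
proof -
  have *: "(\<Sum>i\<le>N. (of_nat (count_msets j i) * z ^ i) * (of_nat (count_msets m (N - i)) * z ^ (N - i))) = of_nat (count_pairs j m N) * z ^ N" for N
    unfolding count_pairs_def of_nat_sum sum_distrib_right
    by (rule sum.cong) (auto simp: algebra_simps simp flip: power_add)
  show ?thesis
    using Cauchy_product_sums[OF count_msets_summable_norm[OF z] count_msets_summable_norm[OF z], of j m]
    unfolding * sums_unique[OF count_msets_sums[OF z], symmetric] .
qed

lemma count_pairs_summable_real:
  fixes r :: real assumes "0 \<le> r" "r < 1"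
  shows "summable (\<lambda>N. real (count_pairs j m N) * r ^ N)"
proof -
  have "summable (\<lambda>N. of_nat (count_pairs j m N) * complex_of_real r ^ N)"
    using count_pairs_sums[of "of_real r" j m] assms by (auto simp: summable_def)
  then have "summable (\<lambda>N. complex_of_real (real (count_pairs j m N) * r ^ N))" by simp
  then show ?thesis by (simp only: summable_of_real_iff)
qed

lemma odd_parts_eq: "odd_parts lam = size (filter_mset odd lam)"
  unfolding odd_parts_def size_multiset_overloaded_eq
  by (rule sum.cong) auto

lemma even_parts_eq: "even_parts lam = size (filter_mset even lam)"
  unfolding even_parts_def size_multiset_overloaded_eq
  by (rule sum.cong) auto

text \<open>A partition corresponds to the multiset of the numbers \<open>a\<close> with \<open>2a + 1\<close> an odd part, together with
the multiset of its halved even parts. The latter is padded with zeros to a prescribed size \<open>m\<close>, so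
the condition of having at most \<open>m\<close> even parts becomes an exact size.\<close>

definition join_odd_even :: "nat multiset \<times> nat multiset \<Rightarrow> nat multiset" where
  "join_odd_even = (\<lambda>(A, B). image_mset (\<lambda>a. 2 * a + 1) A + image_mset (\<lambda>b. 2 * b) (filter_mset (\<lambda>b. b \<noteq> 0) B))"

lemma sum_join: "sum_mset (join_odd_even (A, B)) = 2 * (sum_mset A + sum_mset B) + size A"
proof -
  have "sum_mset (image_mset (\<lambda>a. 2 * a + 1) A) = 2 * sum_mset A + size A"
    by (induction A) auto
  moreover have "sum_mset (image_mset (\<lambda>b. 2 * b) (filter_mset (\<lambda>b. b \<noteq> 0) B)) = 2 * sum_mset B"
    by (induction B) auto
  ultimately show ?thesis by (simp add: join_odd_even_def)
qed

lemma filter_odd_join: "filter_mset odd (join_odd_even (A, B)) = image_mset (\<lambda>a. 2 * a + 1) A"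
  by (simp add: join_odd_even_def filter_mset_image_mset)

lemma filter_even_join: "filter_mset even (join_odd_even (A, B)) = image_mset (\<lambda>b. 2 * b) (filter_mset (\<lambda>b. b \<noteq> 0) B)"
  by (simp add: join_odd_even_def filter_mset_image_mset)

text \<open>The inverse correspondence. The multiset of halved even parts is padded to size \<open>m\<close>, which is possible
if there are at most \<open>m\<close> even parts.\<close>

definition split_odd_even :: "nat \<Rightarrow> nat multiset \<Rightarrow> nat multiset \<times> nat multiset" where
  "split_odd_even m lam = (image_mset (\<lambda>x. x div 2) (filter_mset odd lam),
     image_mset (\<lambda>x. x div 2) (filter_mset even lam) + replicate_mset (m - even_parts lam) 0)"

lemma split_join:
  assumes "size B = m"
  shows "split_odd_even m (join_odd_even (A, B)) = (A, B)"
proof -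
  have B: "B = filter_mset (\<lambda>b. b \<noteq> 0) B + replicate_mset (count B 0) 0"
    using multiset_partition[of B "\<lambda>b. b \<noteq> 0"] by (simp add: filter_eq_replicate_mset)
  then have "size (filter_mset (\<lambda>b. b \<noteq> 0) B) + count B 0 = m"
    using assms by (metis size_replicate_mset size_union)
  then have "m - size (filter_mset (\<lambda>b. b \<noteq> 0) B) = count B 0" by simp
  then show ?thesis using B
    by (simp add: split_odd_even_def filter_odd_join filter_even_join even_parts_eq
        image_mset.compositionality o_def)
qed

lemma join_split:
  assumes "0 \<notin># lam"
  shows "join_odd_even (split_odd_even m lam) = lam"
proof -
  have 1: "image_mset (\<lambda>a. 2 * (a div 2) + 1) (filter_mset odd lam) = image_mset id (filter_mset odd lam)"
    by (rule image_mset_cong) auto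
  have "filter_mset (\<lambda>b. b \<noteq> 0) (image_mset (\<lambda>x. x div 2) (filter_mset even lam)) = image_mset (\<lambda>x. x div 2) (filter_mset even lam)"
    using assms by (subst filter_mset_eq_conv) (auto elim!: evenE, metis mult_0_right not_gr_zero)
  moreover have "image_mset (\<lambda>a. 2 * (a div 2)) (filter_mset even lam) = image_mset id (filter_mset even lam)"
    by (rule image_mset_cong) auto
  moreover have "filter_mset (\<lambda>b. b \<noteq> 0) (replicate_mset k (0::nat)) = {#}" for k :: nat
    by auto
  moreover have "filter_mset odd lam + filter_mset even lam = lam"
    using multiset_partition[of lam odd] by simp
  ultimately show ?thesis using 1
    by (simp only: join_odd_even_def split_odd_even_def case_prod_conv image_mset.compositionality
        o_def filter_union_mset image_mset.id image_mset_empty add_0_right image_mset_union image_mset_id id_def image_ident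
        multiset.map_ident)
qed

lemma card_partitions_odd_even:
  "card {lam \<in> partitions n. odd_parts lam = j \<and> even_parts lam \<le> m} =
    (if j \<le> n \<and> even (n - j) then count_pairs j m ((n - j) div 2) else 0)"
proof -
  let ?L = "{lam \<in> partitions n. odd_parts lam = j \<and> even_parts lam \<le> m}"
  let ?D = "\<lambda>M. {(A, B). size A = j \<and> size B = m \<and> sum_mset A + sum_mset B = (M::nat)}"
  have sz: "size (fst (split_odd_even m lam)) = odd_parts lam"
    "even_parts lam \<le> m \<Longrightarrow> size (snd (split_odd_even m lam)) = m" for lam
    by (auto simp: split_odd_even_def odd_parts_eq even_parts_eq)
  have n: "n = 2 * (sum_mset (fst (split_odd_even m lam)) + sum_mset (snd (split_odd_even m lam))) + j"
    if "lam \<in> ?L" for lam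
    using that sum_join[of "fst (split_odd_even m lam)" "snd (split_odd_even m lam)"] join_split[of lam m] sz[of lam]
    by (simp add: partitions_def)
  show ?thesis
  proof (cases "j \<le> n \<and> even (n - j)")
    case False
    have "?L = {}"
    proof (rule ccontr)
      assume "?L \<noteq> {}"
      then obtain lam where "lam \<in> ?L" by blast
      from n[OF this] False show False by auto
    qed
    then show ?thesis using False by (simp only: card.empty if_False)
  next
    case True
    define M where "M = (n - j) div 2"
    have nM: "n = 2 * M + j" using True by (auto simp: M_def)
    have "bij_betw join_odd_even (?D M) ?L"
    proof (rule bij_betw_byWitness[where f' = "split_odd_even m"])
      show "\<forall>p\<in>?D M. split_odd_even m (join_odd_even p) = p"
        using split_join by auto
      show "\<forall>lam\<in>?L. join_odd_even (split_odd_even m lam) = lam"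
        using join_split by (auto simp: partitions_def)
      show "join_odd_even ` ?D M \<subseteq> ?L"
      proof (rule image_subsetI)
        fix p assume "p \<in> ?D M"
        then obtain A B where p: "p = (A, B)" "size A = j" "size B = m" "sum_mset A + sum_mset B = M" by blast
        have "0 \<notin># join_odd_even p" by (auto simp: join_odd_even_def p(1))
        moreover have "size (filter_mset (\<lambda>b. b \<noteq> 0) B) \<le> m" using p(3) by (metis size_filter_mset_lesseq)
        ultimately show "join_odd_even p \<in> ?L"
          using p nM by (simp add: partitions_def sum_join odd_parts_eq even_parts_eq filter_odd_join filter_even_join)
      qed
      show "split_odd_even m ` ?L \<subseteq> ?D M"
      proof (rule image_subsetI)
        fix lam assume lam: "lam \<in> ?L"
        show "split_odd_even m lam \<in> ?D M"
          using sz[of lam] n[OF lam] nM lam by (auto simp: case_prod_beta)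
      qed
    qed
    then have "card ?L = card (?D M)" by (simp add: bij_betw_same_card)
    also have "?D M = (\<Union>a\<le>M. msets j a \<times> msets m (M - a))"
      by (auto simp: msets_def)
    also have "card \<dots> = (\<Sum>a\<le>M. card (msets j a \<times> msets m (M - a)))"
      by (rule card_UN_disjoint) (auto simp: finite_msets, auto simp: msets_def)
    also have "\<dots> = count_pairs j m M"
      by (simp add: count_pairs_def count_msets_def card_cartesian_product)
    finally show ?thesis using True by (simp only: M_def if_True simp_thms)
  qed
qed

lemma integral_iexp_int:
  fixes k :: int
  shows "(LBINT x:{-pi..pi}. iexp (of_int k * x)) = (if k = 0 then 2 * pi else 0)"
proof (cases "k = 0")
  case True
  then show ?thesis by (simp add: set_lebesgue_integral_def measure_lborel_Icc scaleR_conv_of_real)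
next
  case False
  let ?F = "\<lambda>x::real. iexp (of_int k * x) / (\<i> * of_int k)"
  have "has_bochner_integral lborel (\<lambda>x. indicator {-pi..pi} x *\<^sub>R iexp (of_int k * x)) (?F pi - ?F (-pi))"
  proof (rule has_bochner_integral_FTC_Icc)
    fix x :: real
    show "(?F has_vector_derivative iexp (of_int k * x)) (at x within {-pi..pi})"
      using False by (auto intro!: derivative_eq_intros has_vector_derivative_real_field simp: field_simps)
  qed (auto intro!: continuous_intros)
  moreover have "iexp (of_int k * pi) = iexp (of_int k * (- pi))"
    by (subst exp_eq, rule exI[of _ k]) simp
  ultimately show ?thesis using False
    by (simp add: set_lebesgue_integral_def has_bochner_integral_iff)
qed

text \<open>Extraction of a coefficient of the generating function by integration over the circle of radius \<open>r\<close>.\<close>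

lemma count_pairs_Fourier:
  fixes r :: real assumes r: "0 \<le> r" "r < 1"
  shows "complex_of_real (2 * pi * count_pairs j m M * r ^ M) =
    (LBINT x:{-pi..pi}. (\<Prod>k\<in>{1..j}. 1 / (1 - (r * iexp x) ^ k)) * (\<Prod>k\<in>{1..m}. 1 / (1 - (r * iexp x) ^ k)) * iexp (- (M * x)))"
    (is "_ = (LBINT x:_. ?G x)")
proof -
  let ?c = "\<lambda>N. complex_of_real (count_pairs j m N * r ^ N)"
  let ?f = "\<lambda>N x. indicator {-pi..pi} x *\<^sub>R (?c N * iexp (of_int (int N - int M) * x))"
  have nf: "norm (?f N x) = indicator {-pi..pi} x *\<^sub>R (count_pairs j m N * r ^ N)" for N x
    using r by (simp add: norm_mult norm_power indicator_def)
  have cont: "continuous_on {-pi..pi} (\<lambda>x. ?c N * iexp (of_int (int N - int M) * x))" for N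
    by (intro continuous_intros)
  have int: "integrable lborel (?f N)" for N
    using borel_integrable_atLeastAtMost'[where a = "-pi" and b = pi and f = "\<lambda>x. ?c N * iexp (of_int (int N - int M) * x)", OF cont]
    unfolding set_integrable_def .
  have 1: "(\<lambda>N. integral\<^sup>L lborel (?f N)) sums (\<integral>x. (\<Sum>N. ?f N x) \<partial>lborel)"
  proof (rule sums_integral[OF int])
    show "AE x in lborel. summable (\<lambda>N. norm (?f N x))"
      unfolding nf using count_pairs_summable_real[OF r] by (auto intro!: AE_I2 simp: indicator_def)
    show "summable (\<lambda>N. \<integral>x. norm (?f N x) \<partial>lborel)"
      unfolding nf using count_pairs_summable_real[OF r, of j m] by (simp add: measure_lborel_Icc summable_mult)
  qed
  have 2: "integral\<^sup>L lborel (?f N) = (if N = M then 2 * pi * ?c M else 0)" for N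
  proof -
    have "integral\<^sup>L lborel (?f N) = (LBINT x:{-pi..pi}. ?c N * iexp (of_int (int N - int M) * x))"
      by (simp only: set_lebesgue_integral_def)
    also have "\<dots> = ?c N * (LBINT x:{-pi..pi}. iexp (of_int (int N - int M) * x))"
      by (rule set_integral_mult_right)
    finally show ?thesis by (simp only: integral_iexp_int) auto
  qed
  have 3: "(\<Sum>N. ?f N x) = indicator {-pi..pi} x *\<^sub>R ?G x" for x
  proof -
    have z: "norm (r * iexp x) < 1" using r by (simp add: norm_mult)
    have *: "of_nat (count_pairs j m N) * (r * iexp x) ^ N * iexp (- (M * x)) = ?c N * iexp (of_int (int N - int M) * x)" for N
    proof -
      have "(r * iexp x) ^ N = r ^ N * exp (of_nat N * (\<i> * x))"
        by (simp only: power_mult_distrib exp_of_nat_mult of_real_power)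
      moreover have "exp (of_nat N * (\<i> * x)) * iexp (- (M * x)) = iexp (of_int (int N - int M) * x)"
        by (subst exp_add[symmetric], rule arg_cong[of _ _ exp]) (simp add: algebra_simps)
      ultimately show ?thesis by (simp add: mult.assoc)
    qed
    from sums_mult2[OF count_pairs_sums[OF z], of j m "iexp (- (M * x))"]
    have "(\<lambda>N. ?f N x) sums (indicator {-pi..pi} x *\<^sub>R ?G x)"
      unfolding * by (rule sums_scaleR_right)
    then show ?thesis by (rule sums_unique[symmetric])
  qed
  have "(\<lambda>N. integral\<^sup>L lborel (?f N)) sums (2 * pi * ?c M)"
    unfolding 2 using sums_If_finite_set[of "{M}" "\<lambda>N. 2 * pi * ?c M"] by simp
  with 1 have "2 * pi * ?c M = (\<integral>x. (\<Sum>N. ?f N x) \<partial>lborel)"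
    using sums_unique2 by blast
  then show ?thesis unfolding 3 set_lebesgue_integral_def by (simp add: mult.assoc)
qed

section \<open>Bounds for the characteristic functions\<close>

text \<open>The mean of a geometric law on the natural numbers with ratio \<open>exp (- x)\<close>; its variance is
\<open>geo_mean x + (geo_mean x)\<^sup>2\<close>.\<close>

definition geo_mean :: "real \<Rightarrow> real" where "geo_mean x = 1 / (exp x - 1)"

lemma geo_mean_pos: "x > 0 \<Longrightarrow> geo_mean x > 0" by (simp add: geo_mean_def)

lemma geo_mean_le:
  assumes "x > 0" shows "x * geo_mean x \<le> exp (- x / 2)"
proof -
  have "x / 2 \<le> sinh (x / 2)"
  proof -
    have "sinh 0 - 0 \<le> sinh (x/2) - x/2"
    proof (rule DERIV_nonneg_imp_nondecreasing[of 0 "x/2" "\<lambda>x. sinh x - x"])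
      show "0 \<le> x / 2" using assms by simp
      fix y :: real
      have "((\<lambda>x. sinh x - x) has_real_derivative (cosh y - 1)) (at y)"
        by (auto intro!: derivative_eq_intros)
      then show "\<exists>z. ((\<lambda>x. sinh x - x) has_real_derivative z) (at y) \<and> 0 \<le> z"
        using cosh_real_ge_1[of y] by auto
    qed
    then show ?thesis by simp
  qed
  also have "sinh (x / 2) = (exp x - 1) * exp (- x / 2) / 2"
    by (simp add: sinh_field_def field_simps flip: exp_add)
  finally show ?thesis using assms by (simp add: geo_mean_def field_simps)
qed

text \<open>The characteristic function of a geometric law with mean \<open>w\<close> at \<open>\<eta>\<close> is the reciprocal of
\<open>1 - w * (iexp \<eta> - 1)\<close>.\<close>

lemma cmod_geo_denom:
  fixes w \<eta> :: real
  shows "(cmod (1 - w * (iexp \<eta> - 1)))\<^sup>2 = 1 + 2 * (w + w\<^sup>2) * (1 - cos \<eta>)"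
proof -
  have "(cmod (1 - w * (iexp \<eta> - 1)))\<^sup>2 = (1 + w * (1 - cos \<eta>))\<^sup>2 + (w * sin \<eta>)\<^sup>2"
    by (simp add: cmod_power2 Re_exp Im_exp algebra_simps)
  also have "\<dots> = 1 + 2 * w * (1 - cos \<eta>) + w\<^sup>2 * ((1 - cos \<eta>)\<^sup>2 + (sin \<eta>)\<^sup>2)"
    by algebra
  also have "(1 - cos \<eta>)\<^sup>2 + (sin \<eta>)\<^sup>2 = 2 * (1 - cos \<eta>)"
    by (simp add: sin_squared_eq power2_eq_square algebra_simps)
  finally show ?thesis by (simp add: algebra_simps)
qed

lemma cmod_geo_denom_ge_1:
  fixes w \<eta> :: real
  assumes "w \<ge> 0"
  shows "1 \<le> cmod (1 - w * (iexp \<eta> - 1))"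
proof -
  have "1\<^sup>2 \<le> (cmod (1 - w * (iexp \<eta> - 1)))\<^sup>2"
    unfolding cmod_geo_denom using assms by (auto intro!: mult_nonneg_nonneg)
  then show ?thesis by (rule power2_le_imp_le) simp
qed

lemma jordan_sin:
  assumes "0 \<le> y" "y \<le> pi / 2" shows "2 * y / pi \<le> sin y"
proof -
  have c: "convex_on {0..pi/2} (\<lambda>x. - sin x)"
  proof (rule f''_ge0_imp_convex)
    fix x assume "x \<in> {0..pi/2}"
    then show "0 \<le> sin x" by (auto intro!: sin_ge_zero)
    show "((\<lambda>x. - sin x) has_real_derivative - cos x) (at x)"
      by (auto intro!: derivative_eq_intros)
    show "((\<lambda>x. - cos x) has_real_derivative sin x) (at x)"
      by (auto intro!: derivative_eq_intros)
  qed simp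
  define t where "t = 2 * y / pi"
  have "0 \<le> t" "t \<le> 1" using assms by (auto simp: t_def field_simps)
  from convex_onD[OF c this, of 0 "pi/2"]
  have "- sin (t * (pi/2)) \<le> - t" by simp
  then show ?thesis by (simp add: t_def)
qed

lemma one_minus_cos_ge:
  assumes "\<bar>x\<bar> \<le> pi" shows "x\<^sup>2 / 5 \<le> 1 - cos x"
proof -
  have "2 * \<bar>x / 2\<bar> / pi \<le> sin \<bar>x / 2\<bar>" using assms by (intro jordan_sin) auto
  then have "(\<bar>x\<bar> / pi)\<^sup>2 \<le> (sin \<bar>x / 2\<bar>)\<^sup>2" by (intro power_mono) auto
  also have "(sin \<bar>x / 2\<bar>)\<^sup>2 = (sin (x/2))\<^sup>2" by (simp add: abs_if)
  finally have "2 * (x\<^sup>2 / pi\<^sup>2) \<le> 2 * (sin (x/2))\<^sup>2" by (simp add: power_divide)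
  also have "\<dots> = 1 - cos x" using cos_double_sin[of "x/2"] by simp
  finally have *: "2 * (x\<^sup>2 / pi\<^sup>2) \<le> 1 - cos x" .
  have "pi \<le> 3.15" using pi_approx by simp
  then have "pi\<^sup>2 \<le> 3.15\<^sup>2" by (intro power_mono) auto
  then have "pi\<^sup>2 \<le> 10" by (simp add: power2_eq_square)
  then have "x\<^sup>2 / 5 \<le> 2 * (x\<^sup>2 / pi\<^sup>2)"
    using mult_right_mono[of "pi\<^sup>2" 10 "x\<^sup>2"] by (simp add: field_simps)
  with * show ?thesis by simp
qed

lemma sum_cos_eq: "2 * sin (t/2) * (\<Sum>k=1..K. cos (real k * t)) = sin ((real K + 1/2) * t) - sin (t/2)"
proof (induction K)
  case (Suc K)
  have "2 * sin (t/2) * cos (real (Suc K) * t) = sin (real (Suc K) * t + t/2) - sin (real (Suc K) * t - t/2)"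
    by (simp add: sin_add sin_diff)
  moreover have "real (Suc K) * t + t/2 = (real (Suc K) + 1/2) * t" "real (Suc K) * t - t/2 = (real K + 1/2) * t"
    by (simp_all add: algebra_simps)
  ultimately show ?case using Suc by (simp add: distrib_left)
qed simp

text \<open>For \<open>\<bar>t\<bar> \<le> pi / K\<close> every term is at least a multiple of \<open>(k * t)\<^sup>2\<close>; otherwise the cosines cancel, by the
closed form of the Dirichlet kernel.\<close>

lemma sum_one_minus_cos_ge:
  assumes K: "K \<ge> 1" and t: "\<bar>t\<bar> \<le> pi"
  shows "min (real K / 2) (real K ^ 3 * t\<^sup>2 / 15) \<le> (\<Sum>k=1..K. 1 - cos (real k * t))"
proof (cases "\<bar>t\<bar> \<le> pi / K")
  case True
  have sq: "real K ^ 3 / 3 \<le> (\<Sum>k=1..K. (real k)\<^sup>2)" for K :: nat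
    by (induction K) (auto simp: power2_eq_square power3_eq_cube field_simps)
  have "real K ^ 3 * t\<^sup>2 / 15 \<le> (\<Sum>k=1..K. (real k)\<^sup>2) * (t\<^sup>2 / 5)"
    using mult_right_mono[OF sq[of K], of "t\<^sup>2/5"] by simp
  also have "\<dots> = (\<Sum>k=1..K. (real k * t)\<^sup>2 / 5)"
    by (simp add: sum_distrib_right power_mult_distrib)
  also have "\<dots> \<le> (\<Sum>k=1..K. 1 - cos (real k * t))"
  proof (rule sum_mono)
    fix k assume k: "k \<in> {1..K}"
    have "\<bar>real k * t\<bar> \<le> real K * (pi / K)"
      unfolding abs_mult using k True by (intro mult_mono) auto
    also have "\<dots> = pi" using K by simp
    finally show "(real k * t)\<^sup>2 / 5 \<le> 1 - cos (real k * t)" by (rule one_minus_cos_ge)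
  qed
  finally show ?thesis by simp
next
  case False
  define u where "u = \<bar>t\<bar>"
  have u: "u > pi / K" "u \<le> pi" using False t by (auto simp: u_def)
  have "pi / K > 0" using K by simp
  then have u0: "u > 0" using u by linarith
  have "(\<Sum>k=1..K. cos (real k * t)) = (\<Sum>k=1..K. cos (real k * u))"
    by (rule sum.cong) (auto simp: u_def abs_if)
  also have "\<dots> \<le> K / 2"
  proof -
    have "u / pi \<le> sin (u/2)" using jordan_sin[of "u/2"] u u0 by simp
    then have s: "sin (u/2) > 0" using u0 by (meson divide_pos_pos less_le_trans pi_gt_zero)
    have "2 * sin (u/2) * (\<Sum>k=1..K. cos (real k * u)) \<le> 1"
      unfolding sum_cos_eq using s sin_le_one[of "(real K + 1/2) * u"] by linarith
    also have "1 \<le> 2 * sin (u/2) * (K / 2)"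
    proof -
      have "1 \<le> u / pi * K" using u K by (simp add: field_simps)
      also have "\<dots> \<le> sin (u/2) * K" using \<open>u / pi \<le> sin (u/2)\<close> by (intro mult_right_mono) auto
      finally show ?thesis by simp
    qed
    finally show ?thesis using s by (simp add: mult_le_cancel_left_pos)
  qed
  finally show ?thesis by (simp add: sum_subtractf)
qed

text \<open>The characteristic function of \<open>\<Sum>k=1..j. k * G k\<close> for independent geometric variables \<open>G k\<close> with
ratios \<open>exp (- s * k)\<close>.\<close>

definition phi :: "real \<Rightarrow> nat \<Rightarrow> real \<Rightarrow> complex" where
  "phi s j t = (\<Prod>k\<in>{1..j}. 1 / (1 - geo_mean (s * real k) * (iexp (real k * t) - 1)))"

lemma norm_phi_le_1:
  assumes "s > 0" shows "cmod (phi s j t) \<le> 1"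
  unfolding phi_def prod_norm[symmetric]
proof (rule prod_le_1)
  fix k assume "k \<in> {1..j}"
  then have "0 \<le> geo_mean (s * real k)" using assms by (intro less_imp_le geo_mean_pos) auto
  from cmod_geo_denom_ge_1[OF this, of "k * t"]
  show "0 \<le> cmod (1 / (1 - geo_mean (s * real k) * (iexp (real k * t) - 1))) \<and> cmod (1 / (1 - geo_mean (s * real k) * (iexp (real k * t) - 1))) \<le> 1"
    by (simp add: norm_divide divide_le_eq)
qed

text \<open>Only the factors with \<open>s * k \<le> 1\<close> are kept: there the mean \<open>geo_mean (s * k)\<close> is bounded below.\<close>

lemma norm_phi_exp_le:
  assumes s: "0 < s" and m: "K \<le> m" and K: "real K \<le> 1 / s"
  shows "cmod (phi s m t) \<le> exp (- (\<Sum>k=1..K. 1 - cos (real k * t)) / 4)"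
proof -
  let ?f = "\<lambda>k. cmod (1 / (1 - geo_mean (s * real k) * (iexp (real k * t) - 1)))"
  have f1: "?f k \<le> 1" if "k \<ge> 1" for k
  proof -
    have "0 \<le> geo_mean (s * real k)" using s that by (intro less_imp_le geo_mean_pos) auto
    from cmod_geo_denom_ge_1[OF this, of "k * t"] show ?thesis by (simp add: norm_divide divide_le_eq)
  qed
  have "cmod (phi s m t) = (\<Prod>k=1..m. ?f k)"
    by (simp add: phi_def prod_norm)
  also have "\<dots> = (\<Prod>k=1..K. ?f k) * (\<Prod>k=K+1..m. ?f k)"
    using m prod.ub_add_nat[of 1 K ?f "m - K"] by simp
  also have "\<dots> \<le> (\<Prod>k=1..K. ?f k) * 1"
    by (intro mult_left_mono prod_le_1 prod_nonneg conjI f1) auto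
  also have "(\<Prod>k=1..K. ?f k) \<le> (\<Prod>k=1..K. exp (- (1 - cos (real k * t)) / 4))"
  proof (rule prod_mono, intro conjI)
    fix k assume k: "k \<in> {1..K}"
    let ?w = "geo_mean (s * real k)" and ?c = "1 - cos (real k * t)"
    have c: "0 \<le> ?c" "?c \<le> 2" using cos_ge_minus_one[of "real k * t"] by (auto simp del: cos_ge_minus_one)
    have "s * k \<le> s * K" using k s by (intro mult_left_mono) auto
    also have "\<dots> \<le> s * (1 / s)" using K s by (intro mult_left_mono) auto
    finally have sk: "s * k \<le> 1" "s * k > 0" using s k by auto
    have "exp (s * k) \<le> 3" using sk exp_le[THEN order_trans[rotated], of "exp (s*k)"] by simp
    then have w: "?w \<ge> 1/2" using sk by (simp add: geo_mean_def field_simps)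
    have w2: "?w + ?w\<^sup>2 \<ge> 1/2" using w by (smt (verit) zero_le_power2)
    have "exp (?c / 2) \<le> 1 + ?c / 2 + (?c/2)\<^sup>2" using c by (intro exp_bound) auto
    also have "(?c/2)\<^sup>2 \<le> 1 * (?c/2)" unfolding power2_eq_square using c by (intro mult_right_mono) auto
    also have "1 + ?c/2 + 1 * (?c/2) \<le> 1 + 2 * (?w + ?w\<^sup>2) * ?c" 
      using mult_right_mono[OF w2, of ?c] c unfolding mult.assoc[of 2] by linarith
    also have "\<dots> = (cmod (1 - ?w * (iexp (real k * t) - 1)))\<^sup>2" by (rule cmod_geo_denom[symmetric])
    finally have "(exp (?c / 4))\<^sup>2 \<le> (cmod (1 - ?w * (iexp (real k * t) - 1)))\<^sup>2"
      by (simp add: power2_eq_square flip: exp_add)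
    then have "exp (?c / 4) \<le> cmod (1 - ?w * (iexp (real k * t) - 1))" by (rule power2_le_imp_le) simp
    then have "1 / cmod (1 - ?w * (iexp (real k * t) - 1)) \<le> 1 / exp (?c / 4)" 
      by (rule frac_le[OF zero_le_one order_refl exp_gt_zero])
    also have "\<dots> = exp (- ?c / 4)" by (simp only: exp_minus inverse_eq_divide minus_divide_left[symmetric])
    finally show "?f k \<le> exp (- (1 - cos (real k * t)) / 4)" by (simp add: norm_divide)
  qed simp
  also have "\<dots> = exp (- (\<Sum>k=1..K. 1 - cos (real k * t)) / 4)"
  proof -
    have "- (\<Sum>k=1..K. 1 - cos (real k * t)) / 4 = (\<Sum>k=1..K. - (1 - cos (real k * t)) / 4)"
      by (simp only: sum_negf[symmetric] sum_divide_distrib)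
    then show ?thesis by (simp only: exp_sum finite_atLeastAtMost)
  qed
  finally show ?thesis by simp
qed

text \<open>With \<open>t = s powr (3/2) * u\<close> the right-hand side is a multiple of \<open>1 / (1 + u\<^sup>2)\<close>. This is the integrable
majorant for the whole circle, so no separate treatment of minor arcs is needed.\<close>

lemma norm_phi_bound:
  assumes s: "0 < s" "s \<le> 1/2" and m: "1 / s \<le> real m" and t: "\<bar>t\<bar> \<le> pi"
  shows "cmod (phi s m t) \<le> 2000000 / (1 + t\<^sup>2 / s ^ 3)"
proof -
  define K where "K = nat \<lfloor>1 / s\<rfloor>"
  have K1: "real K \<le> 1 / s" using s by (simp add: K_def)
  have "1 / s < real K + 1" unfolding K_def using s by linarith
  moreover have "1 / s \<ge> 2" using s by (simp add: field_simps)
  ultimately have K2: "real K \<ge> 1 / (2 * s)" "K \<ge> 1" by (auto simp: field_simps)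
  have Km: "K \<le> m" using K1 m by linarith
  define v where "v = t\<^sup>2 / s ^ 3"
  have v: "v \<ge> 0" using s by (simp add: v_def)
  let ?S = "\<Sum>k=1..K. 1 - cos (real k * t)"
  have "min (real K / 2) (real K ^ 3 * t\<^sup>2 / 15) \<le> ?S" by (rule sum_one_minus_cos_ge[OF K2(2) t])
  then consider "?S \<ge> real K / 2" | "?S \<ge> real K ^ 3 * t\<^sup>2 / 15" by linarith
  then have "exp (- ?S / 4) \<le> 2000000 / (1 + v)"
  proof cases
    case 1
    \<comment> \<open>The bound is exponentially small in \<open>1 / s\<close>, hence below a multiple of \<open>s ^ 3\<close>, and \<open>s ^ 3 * (1 + v)\<close> is bounded.\<close>
    define y where "y = 1 / (16 * s)"
    have y: "y > 0" using s by (simp add: y_def)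
    have "?S / 4 \<ge> y" using 1 K2 by (simp add: y_def)
    then have "exp (- ?S / 4) \<le> exp (- y)" by simp
    also have "\<dots> \<le> 27 / y ^ 3"
    proof -
      have "(y / 3) ^ 3 \<le> (1 + y / 3) ^ 3" using y by (intro power_mono) auto
      also have "\<dots> \<le> exp (y/3) ^ 3" using y by (intro power_mono exp_ge_add_one_self) auto
      also have "\<dots> = exp y" by (simp flip: exp_of_nat_mult)
      finally have "y ^ 3 / 27 \<le> exp y" by (simp add: power_divide)
      then show ?thesis using y by (simp add: exp_minus field_simps)
    qed
    also have "27 / y ^ 3 = 110592 * s ^ 3" by (simp add: y_def power3_eq_cube)
    also have "\<dots> \<le> 2000000 / (1 + v)"
    proof -
      have "pi \<le> 3.15" using pi_approx by simp
      have "t\<^sup>2 \<le> 10"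
      proof -
        have "\<bar>t\<bar>\<^sup>2 \<le> 3.15\<^sup>2" using t \<open>pi \<le> 3.15\<close> by (intro power_mono) auto
        then show ?thesis by (simp add: power2_eq_square)
      qed
      have "s ^ 3 * (1 + v) = s ^ 3 + t\<^sup>2" using s by (simp add: v_def field_simps)
      also have "s ^ 3 \<le> (1/2) ^ 3" using s by (intro power_mono) auto
      also have "(1/2) ^ 3 + t\<^sup>2 \<le> (1/2)^3 + 10" using \<open>t\<^sup>2 \<le> 10\<close> by simp
      finally have "s ^ 3 * (1 + v) \<le> 11" by (simp add: power3_eq_cube)
      then show ?thesis using v by (simp add: field_simps)
    qed
    finally show ?thesis .
  next
    case 2
    have "(1 / (2 * s)) ^ 3 \<le> real K ^ 3" using K2 s by (intro power_mono) auto
    then have "(1 / (2 * s)) ^ 3 * t\<^sup>2 / 15 \<le> real K ^ 3 * t\<^sup>2 / 15" by (intro divide_right_mono mult_right_mono) auto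
    with 2 have "?S / 4 \<ge> v / 480" by (simp add: v_def power3_eq_cube field_simps)
    then have "exp (- ?S / 4) \<le> exp (- (v / 480))" by simp
    also have "\<dots> \<le> 1 / (1 + v / 480)" 
      using exp_ge_add_one_self[of "v/480"] v by (simp add: exp_minus field_simps)
    also have "\<dots> \<le> 2000000 / (1 + v)" using v by (simp add: field_simps)
    finally show ?thesis .
  qed
  then show ?thesis
    using norm_phi_exp_le[OF s(1) Km K1, of t] unfolding v_def by linarith
qed

section \<open>Gaussian approximation and moments\<close>

lemma iexp_taylor2: "cmod (iexp x - (1 + \<i> * x - x\<^sup>2 / 2)) \<le> \<bar>x\<bar> ^ 3 / 6"
  using iexp_approx1[of x 2]
  by (simp add: numeral_2_eq_2 power2_eq_square power_mult_distrib fact_numeral eval_nat_numeral algebra_simps)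

lemma exp_neg_taylor1:
  assumes "0 \<le> (y::real)" shows "\<bar>exp (- y) - (1 - y)\<bar> \<le> y\<^sup>2 / 2"
proof -
  have "exp (- y) \<ge> 1 - y" using exp_ge_add_one_self[of "-y"] by simp
  moreover have "exp (- y) \<le> 1 - y + y\<^sup>2 / 2"
  proof -
    have "1 - y + y\<^sup>2/2 - exp (-y) \<ge> 1 - 0 + 0\<^sup>2/2 - exp (-0)"
    proof (rule DERIV_nonneg_imp_nondecreasing[OF assms])
      fix x :: real
      have "((\<lambda>y. 1 - y + y\<^sup>2/2 - exp (-y)) has_real_derivative (- 1 + x + exp (- x))) (at x)"
        by (auto intro!: derivative_eq_intros)
      moreover have "0 \<le> - 1 + x + exp (- x)" using exp_ge_add_one_self[of "-x"] by simp
      ultimately show "\<exists>z. ((\<lambda>y. 1 - y + y\<^sup>2/2 - exp (-y)) has_real_derivative z) (at x) \<and> 0 \<le> z" by blast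
    qed
    then show ?thesis by simp
  qed
  ultimately show ?thesis by linarith
qed

text \<open>The centred geometric characteristic function differs from the Gaussian one with the same variance
only in the third order in \<open>\<eta>\<close>.\<close>

lemma geo_char_approx:
  fixes w \<eta> :: real
  assumes w: "0 \<le> w"
  shows "cmod (iexp (- w * \<eta>) / (1 - w * (iexp \<eta> - 1)) - exp (- ((w + w\<^sup>2) * \<eta>\<^sup>2 / 2)))
    \<le> (w + w\<^sup>2 + w ^ 3) * \<bar>\<eta>\<bar> ^ 3 + (w + w\<^sup>2)\<^sup>2 * \<eta> ^ 4"
proof -
  define z where "z = w * (iexp \<eta> - 1)"
  define y where "y = (w + w\<^sup>2) * \<eta>\<^sup>2 / 2"
  have y: "y \<ge> 0" using w by (simp add: y_def)
  have z1: "1 \<le> cmod (1 - z)" unfolding z_def by (rule cmod_geo_denom_ge_1[OF w])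
  define e1 where "e1 = iexp (- w * \<eta>) - (1 + \<i> * (- w * \<eta>) - (- w * \<eta>)\<^sup>2 / 2)"
  have e1: "cmod e1 \<le> \<bar>w * \<eta>\<bar> ^ 3 / 6" unfolding e1_def using iexp_taylor2[of "- w * \<eta>"] by simp
  define e2 where "e2 = iexp \<eta> - (1 + \<i> * \<eta> - \<eta>\<^sup>2 / 2)"
  have e2: "cmod e2 \<le> \<bar>\<eta>\<bar> ^ 3 / 6" unfolding e2_def by (rule iexp_taylor2)
  define e3 where "e3 = exp (- y) - (1 - y)"
  have e3: "\<bar>e3\<bar> \<le> y\<^sup>2 / 2" unfolding e3_def by (rule exp_neg_taylor1[OF y])
  have "cmod (iexp \<eta> - 1) \<le> \<bar>\<eta>\<bar>" using iexp_approx1[of \<eta> 0] by simp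
  then have zn: "cmod z \<le> w * \<bar>\<eta>\<bar>" using w by (simp add: z_def norm_mult mult_left_mono)
  have id: "iexp (- w * \<eta>) - (1 - z) * exp (- y) = e1 + w * e2 - z * y - (1 - z) * e3"
  proof -
    have i1: "iexp (- w * \<eta>) = e1 + (1 + \<i> * (- w * \<eta>) - (- w * \<eta>)\<^sup>2 / 2)" by (simp add: e1_def)
    have i2: "z = w * (e2 + \<i> * \<eta> - \<eta>\<^sup>2 / 2)" by (simp add: z_def e2_def)
    have i3: "complex_of_real (exp (- y)) = e3 + 1 - y" by (simp add: e3_def)
    have i4: "complex_of_real y = (w + w\<^sup>2) * \<eta>\<^sup>2 / 2" by (simp add: y_def)
    have key: "\<i> * (- w * \<eta>) - (- w * \<eta>)\<^sup>2 / 2 + y + z - w * e2 = 0"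
      unfolding i4 by (subst i2) (simp add: field_simps power2_eq_square)
    have "iexp (- w * \<eta>) - (1 - z) * exp (- y) =
        e1 + w * e2 - z * y - (1 - z) * e3 + (\<i> * (- w * \<eta>) - (- w * \<eta>)\<^sup>2 / 2 + y + z - w * e2)"
      unfolding i1 i3 by (simp add: algebra_simps)
    then show ?thesis unfolding key by simp
  qed
  have "cmod (iexp (- w * \<eta>) / (1 - z) - exp (- y)) = cmod ((iexp (- w * \<eta>) - (1 - z) * exp (- y)) / (1 - z))"
  proof -
    have "1 - z \<noteq> 0" using z1 by auto
    then show ?thesis by (simp add: diff_divide_distrib)
  qed
  also have "\<dots> = cmod (e1 + w * e2 - z * y - (1 - z) * e3) / cmod (1 - z)"
    unfolding id norm_divide ..
  also have "\<dots> \<le> (cmod e1 + w * cmod e2 + cmod z * y + cmod (1 - z) * \<bar>e3\<bar>) / cmod (1 - z)"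
  proof (rule divide_right_mono)
    have "cmod (e1 + w * e2 - z * y - (1 - z) * e3) \<le> cmod e1 + cmod (w * e2) + cmod (z * y) + cmod ((1 - z) * e3)"
      by (meson add_mono norm_triangle_ineq norm_triangle_ineq4 order_trans order_refl)
    then show "cmod (e1 + w * e2 - z * y - (1 - z) * e3) \<le> cmod e1 + w * cmod e2 + cmod z * y + cmod (1 - z) * \<bar>e3\<bar>"
      using w y by (simp add: norm_mult)
  qed simp
  also have "\<dots> = (cmod e1 + w * cmod e2 + cmod z * y) / cmod (1 - z) + \<bar>e3\<bar>"
    using z1 by (auto simp: add_divide_distrib)
  also have "(cmod e1 + w * cmod e2 + cmod z * y) / cmod (1 - z) \<le> (cmod e1 + w * cmod e2 + cmod z * y) / 1"
    using z1 w y by (intro divide_left_mono) (auto intro!: add_nonneg_nonneg)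
  also have "\<dots> \<le> \<bar>w * \<eta>\<bar> ^ 3 / 6 + w * (\<bar>\<eta>\<bar> ^ 3 / 6) + (w * \<bar>\<eta>\<bar>) * y"
    unfolding div_by_1 by (intro add_mono e1 mult_left_mono[OF e2 w] mult_right_mono[OF zn y])
  also have "\<dots> = (w ^ 3 / 6 + w / 6 + (w\<^sup>2 + w ^ 3) / 2) * \<bar>\<eta>\<bar> ^ 3"
    using w by (simp add: y_def abs_mult power_mult_distrib power2_eq_square power3_eq_cube field_simps)
  also have "\<dots> \<le> (w + w\<^sup>2 + w ^ 3) * \<bar>\<eta>\<bar> ^ 3"
    using w by (intro mult_right_mono) (auto simp: field_simps)
  also have "\<bar>e3\<bar> \<le> (w + w\<^sup>2)\<^sup>2 * \<eta> ^ 4"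
  proof -
    have "y\<^sup>2 / 2 = (w + w\<^sup>2)\<^sup>2 * \<eta> ^ 4 / 8" by (simp add: y_def power_divide power_mult_distrib)
    also have "\<dots> \<le> (w + w\<^sup>2)\<^sup>2 * \<eta> ^ 4" by simp
    finally show ?thesis using e3 by linarith
  qed
  finally show ?thesis unfolding z_def y_def by simp
qed

lemma le_exp_self:
  fixes x :: real assumes "0 \<le> x" shows "x \<le> exp x"
  using exp_ge_add_one_self[of x] by linarith

lemma geo_mean_moment3:
  assumes x: "x > 0"
  shows "x ^ 3 * (geo_mean x + (geo_mean x)\<^sup>2 + geo_mean x ^ 3) \<le> 40 * exp (- x / 4)"
proof -
  define w where "w = geo_mean x"
  have w: "w > 0" using geo_mean_pos[OF x] by (simp add: w_def)
  have xw: "x * w \<le> exp (- x / 2)" unfolding w_def by (rule geo_mean_le[OF x])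
  have b1: "x ^ 3 * w \<le> 32 * exp (- x / 4)"
  proof -
    have "x\<^sup>2 \<le> 32 * exp (x / 4)"
      using exp_lower_Taylor_quadratic[of "x/4"] x by (simp add: power2_eq_square)
    then have "x\<^sup>2 * (x * w) \<le> (32 * exp (x / 4)) * exp (- x / 2)" using xw x w by (intro mult_mono) auto
    also have "\<dots> = 32 * exp (- x / 4)" by (simp flip: exp_add)
    finally show ?thesis by (simp add: power2_eq_square power3_eq_cube mult.assoc)
  qed
  have sq: "(x * w)\<^sup>2 \<le> exp (- x)"
  proof -
    have "(x * w)\<^sup>2 \<le> (exp (- x / 2))\<^sup>2" using xw x w by (intro power_mono) auto
    then show ?thesis by (simp add: power2_eq_square flip: exp_add)
  qed
  have b2: "x ^ 3 * w\<^sup>2 \<le> 4 * exp (- x / 4)"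
  proof -
    have "x / 2 \<le> exp (x / 2)" using x by (intro le_exp_self) auto
    then have "x * (x * w)\<^sup>2 \<le> (4 * exp (x / 2)) * exp (- x)" using sq x w by (intro mult_mono) auto
    also have "\<dots> = 4 * exp (- x / 2)" by (simp flip: exp_add)
    also have "\<dots> \<le> 4 * exp (- x / 4)" using x by simp
    finally show ?thesis by (simp add: power2_eq_square power3_eq_cube mult_ac)
  qed
  have b3: "x ^ 3 * w ^ 3 \<le> exp (- x / 4)"
  proof -
    have "(x * w) ^ 3 \<le> exp (- x / 2) ^ 3" using xw x w by (intro power_mono) auto
    also have "\<dots> = exp (- (3 * x / 2))" by (simp flip: exp_of_nat_mult)
    also have "\<dots> \<le> exp (- x / 4)" using x by simp
    finally show ?thesis by (simp add: power_mult_distrib)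
  qed
  have "x ^ 3 * (w + w\<^sup>2 + w ^ 3) = x ^ 3 * w + x ^ 3 * w\<^sup>2 + x ^ 3 * w ^ 3" by (simp add: algebra_simps)
  also have "\<dots> \<le> 32 * exp (- x / 4) + 4 * exp (- x / 4) + exp (- x / 4)" using b1 b2 b3 by linarith
  also have "\<dots> \<le> 40 * exp (- x / 4)" by simp
  finally show ?thesis by (simp add: w_def)
qed

lemma geo_mean_moment2:
  assumes x: "x > 0"
  shows "x\<^sup>2 * (geo_mean x + (geo_mean x)\<^sup>2) \<le> 5 * exp (- x / 4)"
proof -
  define w where "w = geo_mean x"
  have w: "w > 0" using geo_mean_pos[OF x] by (simp add: w_def)
  have xw: "x * w \<le> exp (- x / 2)" unfolding w_def by (rule geo_mean_le[OF x])
  have "x / 4 \<le> exp (x / 4)" using x by (intro le_exp_self) auto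
  then have "x * (x * w) \<le> (4 * exp (x / 4)) * exp (- x / 2)" using xw x w by (intro mult_mono) auto
  also have "\<dots> = 4 * exp (- x / 4)" by (simp flip: exp_add)
  finally have b1: "x * (x * w) \<le> 4 * exp (- x / 4)" .
  have "(x * w)\<^sup>2 \<le> (exp (- x / 2))\<^sup>2" using xw x w by (intro power_mono) auto
  also have "\<dots> = exp (- x)" by (simp add: power2_eq_square flip: exp_add)
  also have "\<dots> \<le> exp (- x / 4)" using x by simp
  finally have b2: "(x * w)\<^sup>2 \<le> exp (- x / 4)" .
  have "x\<^sup>2 * (w + w\<^sup>2) = x * (x * w) + (x * w)\<^sup>2" by (simp add: power2_eq_square algebra_simps)
  then show ?thesis using b1 b2 by (simp add: w_def)
qed

lemma geo_mean_moment4: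
  assumes x: "x > 0"
  shows "x ^ 4 * (geo_mean x + (geo_mean x)\<^sup>2)\<^sup>2 \<le> 25 * exp (- x / 4)"
proof -
  have "(x\<^sup>2 * (geo_mean x + (geo_mean x)\<^sup>2))\<^sup>2 \<le> (5 * exp (- x / 4))\<^sup>2"
    using geo_mean_moment2[OF x] geo_mean_pos[OF x] by (intro power_mono) auto
  also have "\<dots> = 25 * exp (- x / 2)" by (simp add: power2_eq_square flip: exp_add)
  also have "\<dots> \<le> 25 * exp (- x / 4)" using x by simp
  finally show ?thesis by (simp add: power_mult_distrib)
qed

lemma sum_exp_le:
  fixes a :: real assumes a: "a > 0"
  shows "(\<Sum>k=1..j. exp (- (a * real k))) \<le> 1 / a"
proof -
  have *: "(\<Sum>k=1..j. exp (- (a * real k))) * (exp a - 1) = 1 - exp (- (a * real j))"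
    by (induction j) (auto simp: algebra_simps simp flip: exp_add)
  have "(\<Sum>k=1..j. exp (- (a * real k))) * a \<le> (\<Sum>k=1..j. exp (- (a * real k))) * (exp a - 1)"
  proof (intro mult_left_mono sum_nonneg)
    show "a \<le> exp a - 1" using exp_ge_add_one_self[of a] by linarith
  qed simp
  also have "\<dots> \<le> 1" unfolding * by simp
  finally show ?thesis using a by (simp add: field_simps)
qed

lemma sum_moment3:
  assumes s: "s > 0"
  shows "(\<Sum>k=1..j. real k ^ 3 * (geo_mean (s * real k) + (geo_mean (s * real k))\<^sup>2 + geo_mean (s * real k) ^ 3)) \<le> 160 / s ^ 4"
proof -
  have "real k ^ 3 * (geo_mean (s * real k) + (geo_mean (s * real k))\<^sup>2 + geo_mean (s * real k) ^ 3) \<le> 40 / s ^ 3 * exp (- (s / 4 * real k))"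
    if "k \<in> {1..j}" for k
    using geo_mean_moment3[of "s * real k"] s that by (simp add: field_simps)
  then have "(\<Sum>k=1..j. real k ^ 3 * (geo_mean (s * real k) + (geo_mean (s * real k))\<^sup>2 + geo_mean (s * real k) ^ 3))
     \<le> (\<Sum>k=1..j. 40 / s ^ 3 * exp (- (s / 4 * real k)))" by (rule sum_mono)
  also have "\<dots> \<le> 40 / s ^ 3 * (1 / (s / 4))"
    unfolding sum_distrib_left[symmetric] using s by (intro mult_left_mono sum_exp_le) auto
  also have "\<dots> = 160 / s ^ 4" using s by (simp add: field_simps eval_nat_numeral)
  finally show ?thesis .
qed

lemma sum_moment4:
  assumes s: "s > 0"
  shows "(\<Sum>k=1..j. real k ^ 4 * (geo_mean (s * real k) + (geo_mean (s * real k))\<^sup>2)\<^sup>2) \<le> 100 / s ^ 5"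
proof -
  have "real k ^ 4 * (geo_mean (s * real k) + (geo_mean (s * real k))\<^sup>2)\<^sup>2 \<le> 25 / s ^ 4 * exp (- (s / 4 * real k))"
    if "k \<in> {1..j}" for k
    using geo_mean_moment4[of "s * real k"] s that by (simp add: field_simps)
  then have "(\<Sum>k=1..j. real k ^ 4 * (geo_mean (s * real k) + (geo_mean (s * real k))\<^sup>2)\<^sup>2)
     \<le> (\<Sum>k=1..j. 25 / s ^ 4 * exp (- (s / 4 * real k)))" by (rule sum_mono)
  also have "\<dots> \<le> 25 / s ^ 4 * (1 / (s / 4))"
    unfolding sum_distrib_left[symmetric] using s by (intro mult_left_mono sum_exp_le) auto
  also have "\<dots> = 100 / s ^ 5" using s by (simp add: field_simps eval_nat_numeral)
  finally show ?thesis .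
qed

lemma sum_k_power:
  fixes y :: real assumes "y \<noteq> 1"
  shows "(\<Sum>k=1..j. real k * y ^ k) = y / (1 - y)\<^sup>2 - y ^ (j + 1) * ((real j + 1) / (1 - y) + y / (1 - y)\<^sup>2)"
proof -
  have "(\<Sum>k=1..j. real k * y ^ k) * (1 - y)\<^sup>2 = y - y ^ (j + 1) * ((real j + 1) * (1 - y) + y)"
    by (induction j) (simp_all add: algebra_simps power2_eq_square)
  moreover have "1 - y \<noteq> 0" using assms by simp
  moreover have "S = y / d\<^sup>2 - P * (N / d + y / d\<^sup>2)"
    if "S * d\<^sup>2 = y - P * (N * d + y)" "d \<noteq> 0" for S d P N :: real
    using that by (simp add: field_simps power2_eq_square)
  ultimately show ?thesis by blast
qed

section \<open>Mean, variance and the central limit theorem\<close>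

text \<open>The exponent \<open>- 5 / 4\<close> lies between \<open>- 3 / 2\<close> and \<open>- 1\<close>: over \<open>x = s * m\<close> the errors are summable, and
their sum \<open>O(s powr (- 5 / 4))\<close> is of smaller order than the standard deviation \<open>s powr (- 3 / 2)\<close>.\<close>

lemma inverse_square_approx:
  fixes x :: real assumes x: "x > 0"
  shows "exp (- x) / (1 - exp (- x))\<^sup>2 \<le> 1 / x\<^sup>2"
    and "1 / x\<^sup>2 - exp (- x) / (1 - exp (- x))\<^sup>2 \<le> x powr (- 5 / 4)"
proof -
  have eq: "exp (- x) / (1 - exp (- x))\<^sup>2 = (geo_mean x)\<^sup>2 * exp x"
  proof -
    have "geo_mean x = exp (- x) / (1 - exp (- x))"
      using x by (simp add: geo_mean_def exp_minus field_simps)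
    then show ?thesis by (simp add: power_divide power2_eq_square exp_minus)
  qed
  have "(x * geo_mean x)\<^sup>2 \<le> (exp (- x / 2))\<^sup>2"
    using geo_mean_le[OF x] geo_mean_pos[OF x] x by (intro power_mono) auto
  also have "\<dots> = exp (- x)" by (simp add: power2_eq_square flip: exp_add)
  finally have "(x * geo_mean x)\<^sup>2 * exp x \<le> exp (- x) * exp x" by (intro mult_right_mono) auto
  then have "x\<^sup>2 * ((geo_mean x)\<^sup>2 * exp x) \<le> 1" by (simp add: power_mult_distrib flip: exp_add)
  then show 1: "exp (- x) / (1 - exp (- x))\<^sup>2 \<le> 1 / x\<^sup>2"
    unfolding eq using x by (simp add: field_simps)
  show "1 / x\<^sup>2 - exp (- x) / (1 - exp (- x))\<^sup>2 \<le> x powr (- 5 / 4)"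
  proof (cases "x \<ge> 1")
    case True
    have "1 / x\<^sup>2 = x powr (- 2)" using x by (simp add: powr_minus_divide powr_realpow)
    also have "\<dots> \<le> x powr (- 5 / 4)" using True by (intro powr_mono) auto
    finally show ?thesis by (smt (verit) divide_nonneg_nonneg exp_ge_zero zero_le_power2)
  next
    case False
    have y: "1 - exp (- x) \<le> x" "0 < 1 - exp (- x)" using exp_ge_add_one_self[of "-x"] x by auto
    have "(1 - x) / x\<^sup>2 \<le> exp (- x) / (1 - exp (- x))\<^sup>2"
      using y False x by (intro frac_le power_mono) auto
    moreover have "(1 - x) / x\<^sup>2 = 1 / x\<^sup>2 - 1 / x" using x by (simp add: field_simps power2_eq_square)
    moreover have "1 / x = x powr (- 1)" using x by (simp add: powr_minus_divide)
    moreover have "x powr (- 1) \<le> x powr (- 5 / 4)" using False x by (intro powr_mono') auto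
    ultimately show ?thesis by linarith
  qed
qed

lemma sums_abs_le:
  fixes f g :: "nat \<Rightarrow> real"
  assumes "f sums F" "g sums G" "\<And>n. \<bar>f n\<bar> \<le> g n"
  shows "\<bar>F\<bar> \<le> G"
proof -
  have "F \<le> G" using assms by (intro sums_le[OF _ assms(1,2)]) (smt (verit))
  moreover have "- F \<le> G" using assms by (intro sums_le[OF _ sums_minus[OF assms(1)] assms(2)]) (smt (verit))
  ultimately show ?thesis by simp
qed

text \<open>Expanding \<open>geo_mean\<close> into a geometric series and summing over \<open>k\<close> first turns the mean into a sum over
\<open>m\<close> of approximately \<open>1 / (s * m)\<^sup>2\<close>, whence the constant \<open>pi\<^sup>2 / 6\<close>. The condition on \<open>j\<close> makes the omitted
terms with \<open>k > j\<close> negligible.\<close>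

lemma mean_asymp:
  fixes s B :: real
  assumes s: "0 < s" "s \<le> 1" and B: "exp (- s * real j) \<le> B * s" "B * s \<le> 1/2"
  shows "\<bar>pi\<^sup>2 / (6 * s\<^sup>2) - (\<Sum>k=1..j. real k * geo_mean (s * real k))\<bar>
    \<le> ((\<Sum>m. real (Suc m) powr (- 5 / 4)) + 28 * B powr (3/4)) * s powr (- 5 / 4)"
proof -
  define y where "y = (\<lambda>m. exp (- (s * real (Suc m))))"
  define D where "D = (\<lambda>m. \<Sum>k=1..j. real k * y m ^ k)"
  define p where "p = exp (- s * real j)"
  define T where "T = 2 * (real j + 1) / s + 4 / s\<^sup>2"
  have Bpos: "B > 0" using B(1) s(1) by (smt (verit) exp_gt_zero zero_less_mult_pos2)
  have p: "0 < p" "p \<le> 1/2" using B by (auto simp: p_def)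
  have "(\<lambda>m. real k * y m ^ k) sums (real k * geo_mean (s * real k))" if "k \<in> {1..j}" for k
  proof -
    have k: "s * real k > 0" using s that by simp
    have "(\<lambda>m. exp (- (s * real k)) * exp (- (s * real k)) ^ m) sums (exp (- (s * real k)) * (1 / (1 - exp (- (s * real k)))))"
      using k by (intro sums_mult geometric_sums) simp
    also have "exp (- (s * real k)) * (1 / (1 - exp (- (s * real k)))) = geo_mean (s * real k)"
      using k by (simp add: geo_mean_def exp_minus field_simps)
    also have "(\<lambda>m. exp (- (s * real k)) * exp (- (s * real k)) ^ m) = (\<lambda>m. y m ^ k)"
      by (simp add: y_def exp_of_nat_mult[symmetric] exp_add[symmetric] algebra_simps)
    finally show ?thesis by (rule sums_mult)
  qed
  then have D: "D sums (\<Sum>k=1..j. real k * geo_mean (s * real k))"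
    unfolding D_def by (rule sums_sum)
  have "(\<lambda>m. 1 / s\<^sup>2 * (1 / (real m + 1)\<^sup>2)) sums (1 / s\<^sup>2 * (pi\<^sup>2 / 6))"
  proof (rule sums_mult)
    have "(\<lambda>m. 1 / (real m + 1)\<^sup>2) = (\<lambda>m. 1 / real ((m + 1)\<^sup>2))" by (simp add: add.commute)
    then show "(\<lambda>m. 1 / (real m + 1)\<^sup>2) sums (pi\<^sup>2 / 6)" using inverse_squares_sums by simp
  qed
  then have "(\<lambda>m. 1 / (s * real (Suc m))\<^sup>2) sums (pi\<^sup>2 / (6 * s\<^sup>2))"
    by (simp add: power_mult_distrib add.commute mult.commute)
  from sums_diff[OF this D]
  have 1: "(\<lambda>m. 1 / (s * real (Suc m))\<^sup>2 - D m) sums (pi\<^sup>2 / (6 * s\<^sup>2) - (\<Sum>k=1..j. real k * geo_mean (s * real k)))" .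
  have bound: "\<bar>1 / (s * real (Suc m))\<^sup>2 - D m\<bar> \<le> s powr (- 5 / 4) * real (Suc m) powr (- 5 / 4) + T * (p * p ^ m)" for m
  proof -
    define x where "x = s * real (Suc m)"
    have x: "x > 0" using s by (simp add: x_def)
    have yx: "y m = exp (- x)" by (simp add: y_def x_def)
    have y01: "0 < y m" "y m < 1" using x by (auto simp: yx)
    \<comment> \<open>The part of the inner sum that is missing because of the truncation at \<open>j\<close>.\<close>
    define t where "t = y m ^ (j + 1) * ((real j + 1) / (1 - y m) + y m / (1 - y m)\<^sup>2)"
    have Dm: "D m = exp (- x) / (1 - exp (- x))\<^sup>2 - t"
      unfolding D_def t_def using sum_k_power[of "y m" j] y01 by (simp add: yx)
    have t0: "0 \<le> t" using y01 by (auto simp: t_def intro!: mult_nonneg_nonneg add_nonneg_nonneg)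
    have "s / 2 \<le> 1 - exp (- s)"
    proof -
      have "exp (- s) \<le> 1 - s + s\<^sup>2 / 2" using exp_neg_taylor1[of s] s by linarith
      moreover have "s\<^sup>2 \<le> s" using s by (simp add: power2_eq_square mult_left_le)
      ultimately show ?thesis by simp
    qed
    also have "exp (- s) \<ge> y m" using s by (simp add: y_def)
    then have "1 - exp (- s) \<le> 1 - y m" by simp
    finally have sy: "s / 2 \<le> 1 - y m" .
    have "y m ^ (j + 1) \<le> y m ^ j" using y01 by (intro power_decreasing) auto
    also have "y m ^ j = p * p ^ m"
      by (simp add: y_def p_def exp_of_nat_mult[symmetric] exp_add[symmetric] algebra_simps)
    finally have pw: "y m ^ (j + 1) \<le> p * p ^ m" .
    have "(real j + 1) / (1 - y m) \<le> (real j + 1) / (s / 2)" using sy s by (intro divide_left_mono) auto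
    moreover have "y m / (1 - y m)\<^sup>2 \<le> 1 / (s / 2)\<^sup>2" using sy s y01 by (intro frac_le power_mono) auto
    ultimately have "(real j + 1) / (1 - y m) + y m / (1 - y m)\<^sup>2 \<le> T"
      using s by (simp add: T_def power_divide mult.commute)
    then have "t \<le> (p * p ^ m) * T"
      unfolding t_def using pw y01 p by (intro mult_mono add_nonneg_nonneg) auto
    then have tT: "t \<le> T * (p * p ^ m)" by (simp add: mult.commute)
    have "x powr (- 5 / 4) = s powr (- 5 / 4) * real (Suc m) powr (- 5 / 4)"
      using s by (simp add: x_def powr_mult)
    then show ?thesis using inverse_square_approx[OF x] Dm t0 tT unfolding x_def[symmetric] by linarith
  qed
  have "summable (\<lambda>m. real (Suc m) powr (- 5 / 4))"
    using summable_real_powr_iff[of "- 5 / 4"] by (subst summable_Suc_iff) simp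
  then have "(\<lambda>m. real (Suc m) powr (- 5 / 4)) sums (\<Sum>m. real (Suc m) powr (- 5 / 4))" by (rule summable_sums)
  moreover have "(\<lambda>m. p ^ m) sums (1 / (1 - p))" using p by (intro geometric_sums) simp
  ultimately have "(\<lambda>m. s powr (- 5 / 4) * real (Suc m) powr (- 5 / 4) + T * (p * p ^ m)) sums
      (s powr (- 5 / 4) * (\<Sum>m. real (Suc m) powr (- 5 / 4)) + T * (p * (1 / (1 - p))))"
    by (intro sums_add sums_mult)
  from sums_abs_le[OF 1 this bound]
  have main: "\<bar>pi\<^sup>2 / (6 * s\<^sup>2) - (\<Sum>k=1..j. real k * geo_mean (s * real k))\<bar> \<le>
    s powr (- 5 / 4) * (\<Sum>m. real (Suc m) powr (- 5 / 4)) + T * (p * (1 / (1 - p)))" .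
  have "T * (p * (1 / (1 - p))) \<le> T * (p * 2)"
    using p s by (intro mult_left_mono) (auto simp: T_def field_simps)
  also have "\<dots> = 2 * (p * T)" by simp
  also have "p * T \<le> 14 * B powr (3/4) * s powr (- 5 / 4)"
  proof -
    \<comment> \<open>A quarter power of \<open>p = exp (- s * j)\<close> absorbs the factor \<open>j\<close> in \<open>T\<close>.\<close>
    have p34: "p = p powr (3/4) * p powr (1/4)" using p by (simp flip: powr_add)
    have p14: "p powr (1/4) = exp (- (s * real j / 4))" by (simp add: p_def powr_def)
    have "s * real j / 4 \<le> exp (s * real j / 4)" using s by (intro le_exp_self) auto
    then have "exp (- (s * real j / 4)) * (s * real j / 4) \<le> exp (- (s * real j / 4)) * exp (s * real j / 4)"
      by (intro mult_left_mono) auto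
    then have "p powr (1/4) * (s * real j / 4) \<le> 1" unfolding p14 by (simp flip: exp_add)
    then have "p powr (1/4) * real j \<le> 4 / s" using s by (simp add: field_simps)
    moreover have "p powr (1/4) \<le> 1" using p powr_mono2[of "1/4" p 1] by simp
    moreover have "1 \<le> 1 / s" using s by simp
    ultimately have "p powr (1/4) * (real j + 1) \<le> 4 / s + 1 / s" by (simp add: distrib_left)
    then have "p powr (1/4) * (real j + 1) \<le> 5 / s" by simp
    then have a1: "2 * (p powr (1/4) * (real j + 1)) / s \<le> 2 * (5 / s) / s" using s by (intro divide_right_mono) auto
    have a2: "p powr (1/4) * (4 / s\<^sup>2) \<le> 1 * (4 / s\<^sup>2)" using \<open>p powr (1/4) \<le> 1\<close> s by (intro mult_right_mono) auto
    have "p powr (1/4) * T = 2 * (p powr (1/4) * (real j + 1)) / s + p powr (1/4) * (4 / s\<^sup>2)"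
      by (simp add: T_def algebra_simps)
    then have T14: "p powr (1/4) * T \<le> 14 / s\<^sup>2" using a1 a2 by (simp add: power2_eq_square)
    have "p powr (3/4) \<le> (B * s) powr (3/4)" using B(1) p by (intro powr_mono2) (auto simp: p_def)
    then have "p powr (3/4) * (p powr (1/4) * T) \<le> (B * s) powr (3/4) * (14 / s\<^sup>2)"
      using T14 s by (intro mult_mono) (auto simp: T_def)
    also have "(B * s) powr (3/4) * (14 / s\<^sup>2) = 14 * B powr (3/4) * (s powr (3/4) * s powr (-2))"
      using s Bpos by (simp add: powr_mult powr_minus_divide powr_realpow)
    also have "s powr (3/4) * s powr (-2) = s powr (- 5 / 4)" by (simp flip: powr_add)
    finally show ?thesis using p34 by (metis mult.assoc)
  qed
  finally have "T * (p * (1 / (1 - p))) \<le> 28 * B powr (3/4) * s powr (- 5 / 4)" by simp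
  with main show ?thesis by (simp add: algebra_simps)
qed

text \<open>Up to the factor \<open>1 / s\<^sup>2\<close>, the variance of \<open>k * G k\<close> is \<open>scaled_var (s * k)\<close>.\<close>

definition scaled_var :: "real \<Rightarrow> real" where "scaled_var x = x\<^sup>2 * (geo_mean x + (geo_mean x)\<^sup>2)"

lemma scaled_var_isCont: "x > 0 \<Longrightarrow> isCont scaled_var x"
  unfolding scaled_var_def geo_mean_def by (intro continuous_intros) auto

lemma integrable_cauchy: "integrable lborel (\<lambda>x::real. C / (1 + x\<^sup>2))"
proof -
  have "einterval (- \<infinity>) \<infinity> = UNIV" by (auto simp: einterval_def)
  then have "integrable lborel (\<lambda>x::real. inverse (1 + x\<^sup>2))"
    using integrable_inverse_1_plus_square by (simp add: set_integrable_def)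
  then have "integrable lborel (\<lambda>x::real. C * inverse (1 + x\<^sup>2))" by (rule integrable_mult_right)
  then show ?thesis by (simp add: divide_inverse)
qed

lemma dominated_convergence_eventually:
  fixes f :: "'a \<Rightarrow> 'b::{banach, second_countable_topology}"
  assumes "f \<in> borel_measurable M" "\<And>i::nat. h i \<in> borel_measurable M" "integrable M w"
    and lim: "AE x in M. (\<lambda>i. h i x) \<longlonglongrightarrow> f x"
    and bound: "\<forall>\<^sub>F i in sequentially. \<forall>x. norm (h i x) \<le> w x"
  shows "integrable M f" "(\<lambda>i. integral\<^sup>L M (h i)) \<longlonglongrightarrow> integral\<^sup>L M f"
proof -
  obtain N where N: "\<And>n x. N \<le> n \<Longrightarrow> norm (h n x) \<le> w x"
    using bound by (auto simp: eventually_sequentially)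
  have l: "AE x in M. (\<lambda>i. h (i + N) x) \<longlonglongrightarrow> f x"
    using lim by eventually_elim (rule LIMSEQ_ignore_initial_segment)
  have b: "AE x in M. norm (h (i + N) x) \<le> w x" for i using N by simp
  show "integrable M f"
    by (rule integrable_dominated_convergence[OF assms(1) assms(2) assms(3) l b])
  show "(\<lambda>i. integral\<^sup>L M (h i)) \<longlonglongrightarrow> integral\<^sup>L M f"
    by (rule LIMSEQ_offset[of _ N], rule integral_dominated_convergence[OF assms(1) assms(2) assms(3) l b])
qed

lemma exp_quarter_le: "x > 0 \<Longrightarrow> exp (- x / 4) \<le> 32 / (1 + x\<^sup>2)" for x :: real
proof -
  assume x: "x > 0"
  have "(1 + x\<^sup>2) / 32 \<le> exp (x / 4)"
    using exp_lower_Taylor_quadratic[of "x/4"] x by (simp add: power2_eq_square)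
  then show ?thesis using x by (simp add: exp_minus field_simps add_pos_nonneg)
qed

lemma sum_step:
  fixes s x :: real
  assumes s: "s > 0" and x: "x > 0"
  shows "(\<Sum>k=1..j. indicator {s * (real k - 1)<..s * real k} x * h k) =
    (if nat \<lceil>x / s\<rceil> \<le> j then h (nat \<lceil>x / s\<rceil>) else (0::real))"
proof -
  let ?c = "nat \<lceil>x / s\<rceil>"
  have c: "?c \<ge> 1" using s x by (simp add: Suc_le_eq)
  have iff: "x \<in> {s * (real k - 1)<..s * real k} \<longleftrightarrow> k = ?c" if "k \<ge> 1" for k
  proof -
    have "x \<in> {s * (real k - 1)<..s * real k} \<longleftrightarrow> real k - 1 < x / s \<and> x / s \<le> real k"
      using s by (auto simp: field_simps)
    also have "\<dots> \<longleftrightarrow> \<lceil>x / s\<rceil> = int k" by (auto simp: ceiling_eq_iff)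
    also have "\<dots> \<longleftrightarrow> k = ?c" using that by auto
    finally show ?thesis .
  qed
  have "(\<Sum>k=1..j. indicator {s * (real k - 1)<..s * real k} x * h k) = (\<Sum>k=1..j. if k = ?c then h k else 0)"
    by (rule sum.cong) (auto simp: iff indicator_def simp del: greaterThanAtMost_iff)
  also have "\<dots> = (if ?c \<le> j then h ?c else 0)" using c by (simp add: sum.delta)
  finally show ?thesis .
qed

text \<open>The sum is a Riemann sum of \<open>scaled_var\<close>, written as the integral of a step function.\<close>

lemma variance_limit:
  assumes s: "s \<longlonglongrightarrow> 0" "\<forall>\<^sub>F n in sequentially. s n > 0"
    and j: "filterlim (\<lambda>n. s n * real (j n)) at_top sequentially"
  shows "(\<lambda>n. s n * (\<Sum>k=1..j n. scaled_var (s n * real k))) \<longlonglongrightarrow> (\<integral>x. indicator {0<..} x * scaled_var x \<partial>lborel)"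
proof -
  define f where "f = (\<lambda>n x. \<Sum>k=1..j n. indicator {s n * (real k - 1)<..s n * real k} x * scaled_var (s n * real k))"
  have f_neg: "f n x = 0" if "s n > 0" "x \<le> 0" for n x
    unfolding f_def
  proof (intro sum.neutral ballI)
    fix k assume "k \<in> {1..j n}"
    then have "0 \<le> s n * (real k - 1)" using that by (intro mult_nonneg_nonneg) auto
    then show "indicator {s n * (real k - 1)<..s n * real k} x * scaled_var (s n * real k) = 0"
      using that by (auto simp: indicator_def)
  qed
  have lim: "(\<lambda>n. f n x) \<longlonglongrightarrow> indicator {0<..} x * scaled_var x" for x
  proof (cases "x > 0")
    case False
    have "\<forall>\<^sub>F n in sequentially. f n x = 0" using s(2) by eventually_elim (use f_neg False in auto)
    then show ?thesis using False by (simp add: tendsto_eventually)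
  next
    case True
    have ce: "\<forall>\<^sub>F n in sequentially. x \<le> s n * real (nat \<lceil>x / s n\<rceil>) \<and> s n * real (nat \<lceil>x / s n\<rceil>) \<le> x + s n"
      using s(2)
    proof eventually_elim
      case (elim n)
      have "x / s n > 0" using True elim by simp
      then have "real (nat \<lceil>x / s n\<rceil>) \<ge> x / s n" "real (nat \<lceil>x / s n\<rceil>) \<le> x / s n + 1" by linarith+
      then show ?case using elim by (simp add: field_simps)
    qed
    have l1: "(\<lambda>n. s n * real (nat \<lceil>x / s n\<rceil>)) \<longlonglongrightarrow> x"
    proof (rule tendsto_sandwich[OF _ _ tendsto_const])
      show "\<forall>\<^sub>F n in sequentially. x \<le> s n * real (nat \<lceil>x / s n\<rceil>)" using ce by eventually_elim auto
      show "\<forall>\<^sub>F n in sequentially. s n * real (nat \<lceil>x / s n\<rceil>) \<le> x + s n" using ce by eventually_elim auto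
      show "(\<lambda>n. x + s n) \<longlonglongrightarrow> x" using tendsto_add[OF tendsto_const s(1), of x] by simp
    qed
    have l2: "(\<lambda>n. scaled_var (s n * real (nat \<lceil>x / s n\<rceil>))) \<longlonglongrightarrow> scaled_var x"
      by (rule isCont_tendsto_compose[OF scaled_var_isCont[OF True] l1])
    have "\<forall>\<^sub>F n in sequentially. f n x = scaled_var (s n * real (nat \<lceil>x / s n\<rceil>))"
      using s(2) ce j[unfolded filterlim_at_top, rule_format, of "x + 1"] order_tendstoD(2)[OF s(1) zero_less_one]
    proof eventually_elim
      case (elim n)
      have "s n * real (nat \<lceil>x / s n\<rceil>) \<le> s n * real (j n)" using elim by linarith
      then have "nat \<lceil>x / s n\<rceil> \<le> j n" using elim by (simp add: mult_le_cancel_left_pos)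
      then show ?case unfolding f_def using sum_step[OF elim(1) True, where h = "\<lambda>k. scaled_var (s n * real k)" and j = "j n"] by simp
    qed
    then have "(\<lambda>n. f n x) \<longlonglongrightarrow> scaled_var x" using l2 by (simp add: tendsto_cong)
    then show ?thesis using True by simp
  qed
  have bound: "\<forall>\<^sub>F n in sequentially. \<forall>x. norm (f n x) \<le> 160 / (1 + x\<^sup>2)"
    using s(2)
  proof eventually_elim
    case (elim n)
    show ?case
    proof
      fix x :: real
      show "norm (f n x) \<le> 160 / (1 + x\<^sup>2)"
      proof (cases "x > 0")
        case False
        then show ?thesis using f_neg[OF elim] by simp
      next
        case True
        let ?y = "s n * real (nat \<lceil>x / s n\<rceil>)"
        have "x / s n > 0" using True elim by simp
        then have "real (nat \<lceil>x / s n\<rceil>) \<ge> x / s n" by linarith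
        then have y: "x \<le> ?y" using elim by (simp add: field_simps)
        have "\<bar>scaled_var ?y\<bar> \<le> 5 * exp (- ?y / 4)"
          using geo_mean_moment2[of ?y] geo_mean_pos[of ?y] y True by (simp add: scaled_var_def)
        also have "\<dots> \<le> 5 * exp (- x / 4)" using y by simp
        also have "\<dots> \<le> 160 / (1 + x\<^sup>2)" using exp_quarter_le[OF True] by simp
        finally have "\<bar>scaled_var ?y\<bar> \<le> 160 / (1 + x\<^sup>2)" .
        then show ?thesis
          unfolding f_def sum_step[OF elim True] by simp
      qed
    qed
  qed
  have m: "(\<lambda>x. indicator {0<..} x * scaled_var x) \<in> borel_measurable lborel"
    unfolding scaled_var_def geo_mean_def by measurable
  have "(\<lambda>n. integral\<^sup>L lborel (f n)) \<longlonglongrightarrow> (\<integral>x. indicator {0<..} x * scaled_var x \<partial>lborel)"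
  proof (rule dominated_convergence_eventually(2)[OF m _ integrable_cauchy _ bound])
    show "f n \<in> borel_measurable lborel" for n unfolding f_def by measurable
    show "AE x in lborel. (\<lambda>n. f n x) \<longlonglongrightarrow> indicator {0<..} x * scaled_var x" using lim by simp
  qed
  moreover have "\<forall>\<^sub>F n in sequentially. integral\<^sup>L lborel (f n) = s n * (\<Sum>k=1..j n. scaled_var (s n * real k))"
    using s(2)
  proof eventually_elim
    case (elim n)
    have "integral\<^sup>L lborel (f n) = (\<Sum>k=1..j n. \<integral>x. indicator {s n * (real k - 1)<..s n * real k} x * scaled_var (s n * real k) \<partial>lborel)"
      unfolding f_def using elim by (intro Bochner_Integration.integral_sum integrable_mult_left) (auto simp: algebra_simps)
    also have "\<dots> = (\<Sum>k=1..j n. s n * scaled_var (s n * real k))"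
      using elim by (intro sum.cong) (auto simp: algebra_simps)
    finally show ?case by (simp add: sum_distrib_left)
  qed
  ultimately show ?thesis by (simp add: tendsto_cong)
qed

text \<open>The limiting variance of \<open>\<Sum>k=1..j. k * G k\<close> after multiplication by \<open>s ^ 3\<close>.\<close>

definition var_const :: real where "var_const = (\<integral>x. indicator {0<..} x * scaled_var x \<partial>lborel)"

text \<open>The central limit theorem for \<open>\<Sum>k=1..j. k * G k\<close>, normalised by \<open>s powr (3/2)\<close> and centred at
\<open>pi\<^sup>2 / (6 * s\<^sup>2)\<close> instead of at its exact mean.\<close>

lemma phi_limit:
  assumes s: "s \<longlonglongrightarrow> 0" "\<forall>\<^sub>F n in sequentially. s n > 0"
    and j: "\<forall>\<^sub>F n in sequentially. exp (- s n * real (j n)) \<le> B * s n"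
  shows "(\<lambda>n. phi (s n) (j n) (s n powr (3/2) * u) * iexp (- (s n powr (3/2) * u * (pi\<^sup>2 / (6 * (s n)\<^sup>2)))))
    \<longlonglongrightarrow> of_real (exp (- (u\<^sup>2 / 2 * var_const)))"
proof -
  define \<theta> where "\<theta> = (\<lambda>n. s n powr (3/2) * u)"
  define \<mu> where "\<mu> = (\<lambda>n. \<Sum>k=1..j n. real k * geo_mean (s n * real k))"
  define G where "G = (\<lambda>n. s n * (\<Sum>k=1..j n. scaled_var (s n * real k)))"
  have Bs: "(\<lambda>n. B * s n) \<longlonglongrightarrow> 0" using tendsto_mult_right_zero[OF s(1)] by simp
  have sj: "filterlim (\<lambda>n. s n * real (j n)) at_top sequentially"
    unfolding filterlim_at_top
  proof
    fix Z :: real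
    have "\<forall>\<^sub>F n in sequentially. B * s n < exp (- Z)" by (rule order_tendstoD(2)[OF Bs]) simp
    then show "\<forall>\<^sub>F n in sequentially. Z \<le> s n * real (j n)" using j
    proof eventually_elim
      case (elim n)
      then have "exp (- s n * real (j n)) < exp (- Z)" by linarith
      then show ?case by simp
    qed
  qed
  have G: "G \<longlonglongrightarrow> var_const" unfolding G_def var_const_def by (rule variance_limit[OF s sj])
  have mu: "(\<lambda>n. \<theta> n * (\<mu> n - pi\<^sup>2 / (6 * (s n)\<^sup>2))) \<longlonglongrightarrow> 0"
  proof (rule Lim_null_comparison)
    let ?C = "(\<Sum>m. real (Suc m) powr (- 5 / 4)) + 28 * B powr (3/4)"
    show "\<forall>\<^sub>F n in sequentially. norm (\<theta> n * (\<mu> n - pi\<^sup>2 / (6 * (s n)\<^sup>2))) \<le> \<bar>u\<bar> * ?C * s n powr (1/4)"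
      using s(2) j order_tendstoD(2)[OF s(1) zero_less_one] order_tendstoD(2)[OF Bs, of "1/2", simplified]
    proof eventually_elim
      case (elim n)
      have "\<bar>pi\<^sup>2 / (6 * (s n)\<^sup>2) - \<mu> n\<bar> \<le> ?C * s n powr (- 5 / 4)"
        unfolding \<mu>_def using elim by (intro mean_asymp) auto
      then have "norm (\<theta> n * (\<mu> n - pi\<^sup>2 / (6 * (s n)\<^sup>2))) \<le> (s n powr (3/2) * \<bar>u\<bar>) * (?C * s n powr (- 5 / 4))"
        unfolding real_norm_def abs_mult by (intro mult_mono) (auto simp: \<theta>_def abs_mult)
      also have "\<dots> = \<bar>u\<bar> * ?C * (s n powr (3/2) * s n powr (- 5 / 4))" by (simp add: algebra_simps)
      also have "s n powr (3/2) * s n powr (- 5 / 4) = s n powr (1/4)" by (simp flip: powr_add)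
      finally show ?case .
    qed
    have "(\<lambda>n. s n powr (1/4)) \<longlonglongrightarrow> 0 powr (1/4)"
      using s(2) by (intro tendsto_powr2[OF s(1) tendsto_const]) (auto elim: eventually_mono)
    then show "(\<lambda>n. \<bar>u\<bar> * ?C * s n powr (1/4)) \<longlonglongrightarrow> 0" by (intro tendsto_mult_right_zero) simp
  qed
  define P where "P = (\<lambda>n. \<Prod>k\<in>{1..j n}. iexp (- geo_mean (s n * real k) * (real k * \<theta> n)) / (1 - geo_mean (s n * real k) * (iexp (real k * \<theta> n) - 1)))"
  define E where "E = (\<lambda>n. exp (- (u\<^sup>2 / 2 * G n)))"
  have PE: "(\<lambda>n. P n - of_real (E n)) \<longlonglongrightarrow> 0"
  proof (rule Lim_null_comparison)
    show "\<forall>\<^sub>F n in sequentially. norm (P n - of_real (E n)) \<le> 160 * \<bar>u\<bar> ^ 3 * s n powr (1/2) + 100 * u ^ 4 * s n"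
      using s(2)
    proof eventually_elim
      case (elim n)
      let ?w = "\<lambda>k. geo_mean (s n * real k)"
      let ?a = "\<lambda>k. iexp (- ?w k * (real k * \<theta> n)) / (1 - ?w k * (iexp (real k * \<theta> n) - 1))"
      let ?b = "\<lambda>k. complex_of_real (exp (- ((?w k + (?w k)\<^sup>2) * (real k * \<theta> n)\<^sup>2 / 2)))"
      have w: "?w k \<ge> 0" if "k \<in> {1..j n}" for k using that elim by (intro less_imp_le geo_mean_pos) auto
      have t2: "(\<theta> n)\<^sup>2 = (s n) ^ 3 * u\<^sup>2"
      proof -
        have "(s n powr (3/2))\<^sup>2 = s n powr 3" by (simp add: power2_eq_square flip: powr_add)
        then show ?thesis using elim by (simp add: \<theta>_def power_mult_distrib powr_realpow)
      qed
      have E: "of_real (E n) = (\<Prod>k\<in>{1..j n}. ?b k)"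
      proof -
        have "u\<^sup>2 / 2 * G n = (\<Sum>k=1..j n. (?w k + (?w k)\<^sup>2) * (real k * \<theta> n)\<^sup>2 / 2)"
          unfolding G_def scaled_var_def sum_distrib_left
        proof (rule sum.cong[OF refl])
          fix k
          show "u\<^sup>2 / 2 * (s n * ((s n * real k)\<^sup>2 * (?w k + (?w k)\<^sup>2))) = (?w k + (?w k)\<^sup>2) * (real k * \<theta> n)\<^sup>2 / 2"
            unfolding power_mult_distrib t2 by (simp add: power2_eq_square power3_eq_cube)
        qed
        then show ?thesis unfolding E_def of_real_prod[symmetric] by (simp add: exp_sum flip: sum_negf)
      qed
      have "norm (P n - of_real (E n)) \<le> (\<Sum>k\<in>{1..j n}. norm (?a k - ?b k))"
        unfolding P_def E
      proof (rule norm_prod_diff)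
        fix k assume k: "k \<in> {1..j n}"
        show "norm (?a k) \<le> 1"
          using cmod_geo_denom_ge_1[OF w[OF k], of "real k * \<theta> n"] by (simp add: norm_divide divide_le_eq)
        show "norm (?b k) \<le> 1" using w[OF k] by (simp add: norm_of_real)
      qed
      also have "\<dots> \<le> (\<Sum>k\<in>{1..j n}. (?w k + (?w k)\<^sup>2 + ?w k ^ 3) * \<bar>real k * \<theta> n\<bar> ^ 3 + (?w k + (?w k)\<^sup>2)\<^sup>2 * (real k * \<theta> n) ^ 4)"
        by (intro sum_mono geo_char_approx w)
      also have "\<dots> = \<bar>\<theta> n\<bar> ^ 3 * (\<Sum>k=1..j n. real k ^ 3 * (?w k + (?w k)\<^sup>2 + ?w k ^ 3)) + \<theta> n ^ 4 * (\<Sum>k=1..j n. real k ^ 4 * (?w k + (?w k)\<^sup>2)\<^sup>2)"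
        unfolding sum_distrib_left sum.distrib[symmetric]
        by (intro sum.cong) (auto simp: abs_mult power_mult_distrib algebra_simps)
      also have "\<dots> \<le> \<bar>\<theta> n\<bar> ^ 3 * (160 / (s n) ^ 4) + \<theta> n ^ 4 * (100 / (s n) ^ 5)"
        by (intro add_mono mult_left_mono sum_moment3 sum_moment4 elim) auto
      also have "\<bar>\<theta> n\<bar> ^ 3 = \<bar>u\<bar> ^ 3 * (s n powr (1/2) * (s n) ^ 4)"
      proof -
        have "(s n powr (3/2)) ^ 3 = s n powr (9/2)" by (simp add: power3_eq_cube flip: powr_add)
        also have "\<dots> = s n powr (1/2) * s n powr 4" by (simp flip: powr_add)
        finally show ?thesis using elim by (simp add: \<theta>_def abs_mult power_mult_distrib powr_realpow)
      qed
      also have "\<theta> n ^ 4 = u ^ 4 * (s n * (s n) ^ 5)"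
      proof -
        have "\<theta> n ^ 4 = ((\<theta> n)\<^sup>2)\<^sup>2" by simp
        also have "\<dots> = ((s n) ^ 3 * u\<^sup>2)\<^sup>2" by (simp only: t2)
        finally show ?thesis by (simp add: power_mult_distrib eval_nat_numeral)
      qed
      finally show ?case using elim by (simp add: field_simps)
    qed
    have "(\<lambda>n. s n powr (1/2)) \<longlonglongrightarrow> 0 powr (1/2)"
      using s(2) by (intro tendsto_powr2[OF s(1) tendsto_const]) (auto elim: eventually_mono)
    then have "(\<lambda>n. 160 * \<bar>u\<bar> ^ 3 * s n powr (1/2) + 100 * u ^ 4 * s n) \<longlonglongrightarrow> 160 * \<bar>u\<bar> ^ 3 * 0 + 100 * u ^ 4 * 0"
      by (intro tendsto_intros s(1)) simp
    then show "(\<lambda>n. 160 * \<bar>u\<bar> ^ 3 * s n powr (1/2) + 100 * u ^ 4 * s n) \<longlonglongrightarrow> 0" by simp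
  qed
  have "(\<lambda>n. complex_of_real (E n)) \<longlonglongrightarrow> of_real (exp (- (u\<^sup>2 / 2 * var_const)))"
    unfolding E_def by (intro tendsto_intros G)
  from tendsto_add[OF PE this]
  have P: "P \<longlonglongrightarrow> of_real (exp (- (u\<^sup>2 / 2 * var_const)))" by simp
  have "(\<lambda>n. iexp (\<theta> n * (\<mu> n - pi\<^sup>2 / (6 * (s n)\<^sup>2)))) \<longlonglongrightarrow> iexp 0"
    by (intro tendsto_intros mu)
  from tendsto_mult[OF P this]
  have "(\<lambda>n. P n * iexp (\<theta> n * (\<mu> n - pi\<^sup>2 / (6 * (s n)\<^sup>2)))) \<longlonglongrightarrow> of_real (exp (- (u\<^sup>2 / 2 * var_const)))"
    by simp
  moreover have "P n * iexp (\<theta> n * (\<mu> n - pi\<^sup>2 / (6 * (s n)\<^sup>2))) =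
     phi (s n) (j n) (\<theta> n) * iexp (- (\<theta> n * (pi\<^sup>2 / (6 * (s n)\<^sup>2))))" for n
  proof -
    have "(\<Prod>k\<in>{1..j n}. iexp (- geo_mean (s n * real k) * (real k * \<theta> n))) = iexp (- (\<theta> n * \<mu> n))"
      by (simp add: exp_sum[symmetric] \<mu>_def sum_distrib_left sum_negf algebra_simps)
    then have "P n = phi (s n) (j n) (\<theta> n) * iexp (- (\<theta> n * \<mu> n))"
      by (simp add: P_def phi_def prod_dividef)
    moreover have "iexp (- (\<theta> n * \<mu> n)) * iexp (\<theta> n * (\<mu> n - pi\<^sup>2 / (6 * (s n)\<^sup>2))) = iexp (- (\<theta> n * (pi\<^sup>2 / (6 * (s n)\<^sup>2))))"
      unfolding exp_add[symmetric] by (rule arg_cong[of _ _ exp]) (simp add: algebra_simps)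
    ultimately show ?thesis by (simp only: mult.assoc)
  qed
  ultimately show ?thesis by (simp only: \<theta>_def)
qed

section \<open>The local limit theorem\<close>

text \<open>The probability, rescaled by the factor \<open>s powr (- 3 / 2)\<close>, that two independent sums of the kind
above, of lengths \<open>j\<close> and \<open>m\<close>, add up to \<open>M\<close>.\<close>

definition local_prob :: "real \<Rightarrow> nat \<Rightarrow> nat \<Rightarrow> nat \<Rightarrow> real" where
  "local_prob s j m M = s powr (- 3 / 2) * (count_pairs j m M * exp (- s * M) *
     ((\<Prod>k\<in>{1..j}. 1 - exp (- s * real k)) * (\<Prod>k\<in>{1..m}. 1 - exp (- s * real k))))"

lemma gen_eq_phi:
  assumes s: "s > 0"
  shows "complex_of_real (\<Prod>k\<in>{1..j}. 1 - exp (- s * real k)) * (\<Prod>k\<in>{1..j}. 1 / (1 - (complex_of_real (exp (- s)) * iexp x) ^ k)) = phi s j x"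
  unfolding phi_def of_real_prod prod.distrib[symmetric]
proof (rule prod.cong[OF refl])
  fix k assume "k \<in> {1..j}"
  then have sk: "s * real k > 0" using s by simp
  define Q where "Q = exp (- s * real k)"
  have Q: "0 < Q" "Q < 1" using sk by (auto simp: Q_def)
  have "(complex_of_real (exp (- s)) * iexp x) ^ k = Q * iexp (real k * x)"
    by (simp add: power_mult_distrib Q_def exp_of_nat_mult[symmetric] algebra_simps flip: of_real_power)
  moreover have "geo_mean (s * real k) = Q / (1 - Q)"
    using sk by (simp add: geo_mean_def Q_def exp_minus field_simps)
  moreover have "(1 - complex_of_real Q) * (1 / (1 - Q * e)) = 1 / (1 - (Q / (1 - Q)) * (e - 1))" for e :: complex
  proof -
    have nz: "1 - complex_of_real Q \<noteq> 0" using Q by (metis eq_iff_diff_eq_0 less_irrefl of_real_1 of_real_eq_iff)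
    have "1 - (complex_of_real Q / (1 - Q)) * (e - 1) = (1 - Q * e) / (1 - Q)"
      using nz by (simp add: field_simps)
    then show ?thesis by simp
  qed
  ultimately show "complex_of_real (1 - exp (- s * real k)) * (1 / (1 - (complex_of_real (exp (- s)) * iexp x) ^ k)) =
      1 / (1 - geo_mean (s * real k) * (iexp (real k * x) - 1))"
    by (simp add: Q_def)
qed

lemma local_prob_integral:
  assumes s: "s > 0"
  defines "a \<equiv> s powr (3/2)"
  shows "complex_of_real (2 * pi * local_prob s j m M) =
    (\<integral>u. indicator {- pi / a .. pi / a} u *\<^sub>R (phi s j (a * u) * phi s m (a * u) * iexp (- (M * (a * u)))) \<partial>lborel)"
proof -
  have a: "a > 0" using s by (simp add: a_def)
  have aa: "s powr (- 3 / 2) = 1 / a" by (simp add: a_def powr_minus_divide)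
  let ?P = "\<lambda>j. complex_of_real (\<Prod>k\<in>{1..j}. 1 - exp (- s * real k))"
  let ?G = "\<lambda>j x. \<Prod>k\<in>{1..j}. 1 / (1 - (complex_of_real (exp (- s)) * iexp x) ^ k)"
  have "exp (- s * M) = exp (- s) ^ M" by (simp add: exp_of_nat_mult[symmetric] mult.commute)
  then have 1: "complex_of_real (2 * pi * local_prob s j m M) = of_real (1 / a) * (?P j * ?P m) * complex_of_real (2 * pi * count_pairs j m M * exp (- s) ^ M)"
    unfolding local_prob_def aa by (simp add: mult_ac)
  have 2: "complex_of_real (2 * pi * count_pairs j m M * exp (- s) ^ M) = (LBINT x:{-pi..pi}. ?G j x * ?G m x * iexp (- (M * x)))"
    using s by (intro count_pairs_Fourier) auto
  let ?h = "\<lambda>x::real. phi s j x * phi s m x * iexp (- (real M * x))"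
  have "(?P j * ?P m) * (?G j x * ?G m x * iexp (- (M * x))) = ?h x" for x :: real
    unfolding gen_eq_phi[OF s, symmetric] by (simp add: mult_ac)
  then have 3: "(?P j * ?P m) * (LBINT x:{-pi..pi}. ?G j x * ?G m x * iexp (- (M * x))) = (LBINT x:{-pi..pi}. ?h x)"
    by (simp only: set_integral_mult_right[symmetric])
  have 4: "(\<integral>x. indicator {-pi..pi} x *\<^sub>R ?h x \<partial>lborel) = \<bar>a\<bar> *\<^sub>R (\<integral>u. indicator {-pi..pi} (0 + a * u) *\<^sub>R ?h (0 + a * u) \<partial>lborel)"
    by (rule lborel_integral_real_affine[where t = 0 and c = a and f = "\<lambda>x. indicator {-pi..pi} x *\<^sub>R ?h x"]) (use a in simp)
  have "indicator {-pi..pi} (0 + a * u) = (indicator {- pi / a .. pi / a} u :: real)" for u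
    using a by (auto simp: indicator_def field_simps)
  then have 5: "(LBINT x:{-pi..pi}. ?h x) = a *\<^sub>R (\<integral>u. indicator {- pi / a .. pi / a} u *\<^sub>R ?h (a * u) \<partial>lborel)"
    using 4 a by (simp only: set_lebesgue_integral_def abs_of_pos add_0)
  show ?thesis unfolding 1 2 mult.assoc[of "of_real (1 / a)"] 3 5 using a by (simp add: scaleR_conv_of_real)
qed

lemma local_prob_integrand_bound:
  assumes s: "0 < s" "s \<le> 1/2" and m: "1 / s \<le> real m"
  defines "a \<equiv> s powr (3/2)"
  shows "norm (indicator {- pi / a .. pi / a} u *\<^sub>R (phi s j (a * u) * phi s m (a * u) * iexp (- (M * (a * u)))))
    \<le> 2000000 / (1 + u\<^sup>2)"
proof (cases "u \<in> {- pi / a .. pi / a}")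
  case True
  have a: "a > 0" using s by (simp add: a_def)
  have "\<bar>a * u\<bar> \<le> pi" using True a by (auto simp: abs_le_iff field_simps)
  then have "cmod (phi s m (a * u)) \<le> 2000000 / (1 + (a * u)\<^sup>2 / s ^ 3)" by (rule norm_phi_bound[OF s m])
  also have "(a * u)\<^sup>2 / s ^ 3 = u\<^sup>2"
  proof -
    have "a\<^sup>2 = s powr 3" by (simp add: a_def power2_eq_square flip: powr_add)
    then show ?thesis using s by (simp add: power_mult_distrib powr_realpow)
  qed
  finally have 1: "cmod (phi s m (a * u)) \<le> 2000000 / (1 + u\<^sup>2)" .
  have "cmod (phi s j (a * u)) * cmod (phi s m (a * u)) \<le> 1 * (2000000 / (1 + u\<^sup>2))"
    using norm_phi_le_1[OF s(1)] 1 by (intro mult_mono) auto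
  then show ?thesis using True by (simp add: norm_mult)
qed simp

lemma phi_measurable [measurable]: "phi s j \<in> borel_measurable borel"
  unfolding phi_def by measurable

text \<open>The bound for \<open>local_prob\<close> that the integrable majorant gives, uniformly in \<open>j\<close> and \<open>M\<close>.\<close>

definition local_bound :: real where
  "local_bound = (\<integral>u. 2000000 / (1 + u\<^sup>2) \<partial>lborel) / (2 * pi)"

lemma local_prob_le_bound:
  assumes "0 < s" "s \<le> 1/2" "1 / s \<le> real m"
  shows "\<bar>local_prob s j m M\<bar> \<le> local_bound"
proof -
  define a where "a = s powr (3/2)"
  define f where "f = (\<lambda>u. indicator {- pi / a .. pi / a} u *\<^sub>R (phi s j (a * u) * phi s m (a * u) * iexp (- (M * (a * u)))))"
  have f: "norm (f u) \<le> 2000000 / (1 + u\<^sup>2)" for u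
    unfolding f_def a_def by (rule local_prob_integrand_bound[OF assms])
  have "f \<in> borel_measurable lborel" unfolding f_def by measurable
  then have "integrable lborel f"
    by (rule Bochner_Integration.integrable_bound[OF integrable_cauchy[of 2000000]]) (use f in \<open>auto intro: order_trans\<close>)
  then have "cmod (integral\<^sup>L lborel f) \<le> (\<integral>u. 2000000 / (1 + u\<^sup>2) \<partial>lborel)"
    by (rule Bochner_Integration.integral_norm_bound_integral[OF _ integrable_cauchy]) (rule f)
  also have "integral\<^sup>L lborel f = complex_of_real (2 * pi * local_prob s j m M)"
    unfolding local_prob_integral[OF assms(1)] f_def a_def ..
  finally have "cmod (complex_of_real (2 * pi * local_prob s j m M)) \<le> (\<integral>u. 2000000 / (1 + u\<^sup>2) \<partial>lborel)" .
  then show ?thesis unfolding norm_of_real by (simp add: local_bound_def abs_mult field_simps)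
qed

text \<open>The limit of \<open>local_prob\<close>: the density at \<open>0\<close> of the Gaussian law with variance \<open>2 * var_const\<close>.\<close>

definition local_const :: real where
  "local_const = (\<integral>u. exp (- (u\<^sup>2 * var_const)) \<partial>lborel) / (2 * pi)"

text \<open>The local limit theorem. The value of the limit is irrelevant because it cancels in the final
quotient; what matters is that it is positive and does not depend on the sequences \<open>j\<close> and \<open>m\<close>.\<close>

lemma local_limit:
  assumes s: "s \<longlonglongrightarrow> 0" "\<forall>\<^sub>F n in sequentially. s n > 0"
    and j: "\<forall>\<^sub>F n in sequentially. exp (- s n * real (j n)) \<le> B * s n"
    and m: "\<forall>\<^sub>F n in sequentially. exp (- s n * real (m n)) \<le> B * s n"
    and M: "(\<lambda>n. s n powr (3/2) * (real (M n) - pi\<^sup>2 / (3 * (s n)\<^sup>2))) \<longlonglongrightarrow> 0"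
  shows "local_const > 0" "(\<lambda>n. local_prob (s n) (j n) (m n) (M n)) \<longlonglongrightarrow> local_const"
proof -
  define a where "a = (\<lambda>n. s n powr (3/2))"
  define f where "f = (\<lambda>n u. indicator {- pi / a n .. pi / a n} u *\<^sub>R
     (phi (s n) (j n) (a n * u) * phi (s n) (m n) (a n * u) * iexp (- (M n * (a n * u)))))"
  define g where "g = (\<lambda>u. complex_of_real (exp (- (u\<^sup>2 * var_const))))"
  have a0: "a \<longlonglongrightarrow> 0"
  proof -
    have "(\<lambda>n. s n powr (3/2)) \<longlonglongrightarrow> 0 powr (3/2)"
      using s(2) by (intro tendsto_powr2[OF s(1) tendsto_const]) (auto elim: eventually_mono)
    then show ?thesis by (simp add: a_def)
  qed
  have Bs: "(\<lambda>n. B * s n) \<longlonglongrightarrow> 0" using tendsto_mult_right_zero[OF s(1)] by simp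
  have lim: "(\<lambda>n. f n u) \<longlonglongrightarrow> g u" for u
  proof -
    let ?c = "\<lambda>n. pi\<^sup>2 / (6 * (s n)\<^sup>2)"
    have l1: "(\<lambda>n. phi (s n) (j n) (a n * u) * iexp (- (a n * u * ?c n))) \<longlonglongrightarrow> of_real (exp (- (u\<^sup>2 / 2 * var_const)))"
      unfolding a_def by (rule phi_limit[OF s j])
    have l2: "(\<lambda>n. phi (s n) (m n) (a n * u) * iexp (- (a n * u * ?c n))) \<longlonglongrightarrow> of_real (exp (- (u\<^sup>2 / 2 * var_const)))"
      unfolding a_def by (rule phi_limit[OF s m])
    have "(\<lambda>n. iexp (- (u * (a n * (real (M n) - pi\<^sup>2 / (3 * (s n)\<^sup>2)))))) \<longlonglongrightarrow> iexp (- (u * 0))"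
      unfolding a_def by (intro tendsto_intros M)
    from tendsto_mult[OF tendsto_mult[OF l1 l2] this]
    have l3: "(\<lambda>n. phi (s n) (j n) (a n * u) * iexp (- (a n * u * ?c n)) * (phi (s n) (m n) (a n * u) * iexp (- (a n * u * ?c n)))
        * iexp (- (u * (a n * (real (M n) - pi\<^sup>2 / (3 * (s n)\<^sup>2)))))) \<longlonglongrightarrow> g u"
      by (simp add: g_def mult.commute flip: of_real_mult exp_add)
    have e: "phi (s n) (j n) (a n * u) * iexp (- (a n * u * ?c n)) * (phi (s n) (m n) (a n * u) * iexp (- (a n * u * ?c n)))
        * iexp (- (u * (a n * (real (M n) - pi\<^sup>2 / (3 * (s n)\<^sup>2))))) =
       phi (s n) (j n) (a n * u) * phi (s n) (m n) (a n * u) * iexp (- (M n * (a n * u)))" for n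
    proof -
      have "- (a n * u * ?c n) + - (a n * u * ?c n) + - (u * (a n * (real (M n) - pi\<^sup>2 / (3 * (s n)\<^sup>2)))) = - (M n * (a n * u))"
        by (simp add: field_simps)
      then have "iexp (- (a n * u * ?c n)) * iexp (- (a n * u * ?c n)) * iexp (- (u * (a n * (real (M n) - pi\<^sup>2 / (3 * (s n)\<^sup>2))))) = iexp (- (M n * (a n * u)))"
        by (simp only: exp_add[symmetric] distrib_left[symmetric] of_real_add[symmetric])
      moreover have "A * x * (A' * x) * y = A * A' * (x * x * y)" for A A' x y :: complex
        by (simp only: mult_ac)
      ultimately show ?thesis by (simp only:)
    qed
    have "\<forall>\<^sub>F n in sequentially. a n * \<bar>u\<bar> < pi"
      using tendsto_mult[OF a0 tendsto_const[of "\<bar>u\<bar>"]] by (intro order_tendstoD(2)) auto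
    then have "\<forall>\<^sub>F n in sequentially. f n u = phi (s n) (j n) (a n * u) * phi (s n) (m n) (a n * u) * iexp (- (M n * (a n * u)))"
      using s(2)
    proof eventually_elim
      case (elim n)
      then have "a n > 0" by (simp add: a_def)
      then have "u \<in> {- pi / a n .. pi / a n}" using elim by (auto simp: field_simps abs_if split: if_splits) (smt (verit) mult_nonneg_nonneg mult_nonpos_nonneg pi_ge_zero)+
      then show ?case by (simp add: f_def)
    qed
    then show ?thesis using l3 unfolding e by (simp add: tendsto_cong)
  qed
  have "\<forall>\<^sub>F n in sequentially. B * s n < exp (- 1)" by (rule order_tendstoD(2)[OF Bs]) simp
  moreover have "\<forall>\<^sub>F n in sequentially. s n < 1/2" by (rule order_tendstoD(2)[OF s(1)]) simp
  ultimately have bound: "\<forall>\<^sub>F n in sequentially. \<forall>u. norm (f n u) \<le> 2000000 / (1 + u\<^sup>2)"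
    using s(2) m
  proof eventually_elim
    case (elim n)
    have "exp (- s n * real (m n)) < exp (- 1)" using elim by linarith
    then have "1 < s n * real (m n)" by simp
    then have "1 / s n \<le> real (m n)" using elim by (simp add: field_simps)
    then show ?case unfolding f_def a_def using elim by (intro allI local_prob_integrand_bound) auto
  qed
  have gm: "g \<in> borel_measurable lborel" unfolding g_def by measurable
  have fm: "f n \<in> borel_measurable lborel" for n unfolding f_def by measurable
  have int: "integrable lborel g"
    by (rule dominated_convergence_eventually(1)[OF gm fm integrable_cauchy _ bound]) (use lim in simp)
  have conv: "(\<lambda>n. integral\<^sup>L lborel (f n)) \<longlonglongrightarrow> integral\<^sup>L lborel g"
    by (rule dominated_convergence_eventually(2)[OF gm fm integrable_cauchy _ bound]) (use lim in simp)
  have intr: "integrable lborel (\<lambda>u. exp (- (u\<^sup>2 * var_const)))"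
    using int unfolding g_def by (simp only: complex_of_real_integrable_eq)
  have gK: "integral\<^sup>L lborel g = of_real (2 * pi * local_const)"
    unfolding g_def local_const_def by simp
  have "0 < (\<integral>u. exp (- \<bar>var_const\<bar>) * indicator {0..1::real} u \<partial>lborel)" by simp
  also have "\<dots> \<le> (\<integral>u. exp (- (u\<^sup>2 * var_const)) \<partial>lborel)"
  proof (rule integral_mono[OF _ intr])
    fix u :: real
    have "u\<^sup>2 * var_const \<le> \<bar>var_const\<bar>" if "0 \<le> u" "u \<le> 1"
    proof -
      have "u\<^sup>2 * var_const \<le> u\<^sup>2 * \<bar>var_const\<bar>" by (intro mult_left_mono) auto
      also have "\<dots> \<le> 1 * \<bar>var_const\<bar>" using that by (intro mult_right_mono power_le_one) auto
      finally show ?thesis by simp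
    qed
    then show "exp (- \<bar>var_const\<bar>) * indicator {0..1} u \<le> exp (- (u\<^sup>2 * var_const))" by (simp add: indicator_def)
  qed simp
  finally show "local_const > 0" by (simp add: local_const_def)
  have "\<forall>\<^sub>F n in sequentially. integral\<^sup>L lborel (f n) = of_real (2 * pi * local_prob (s n) (j n) (m n) (M n))"
    using s(2)
  proof eventually_elim
    case (elim n)
    show ?case unfolding local_prob_integral[OF elim] f_def a_def ..
  qed
  from Lim_transform_eventually[OF conv this]
  have "(\<lambda>n. complex_of_real (2 * pi * local_prob (s n) (j n) (m n) (M n))) \<longlonglongrightarrow> of_real (2 * pi * local_const)"
    unfolding gK .
  then have "(\<lambda>n. 2 * pi * local_prob (s n) (j n) (m n) (M n)) \<longlonglongrightarrow> 2 * pi * local_const" by (rule tendsto_of_real_iff[THEN iffD1])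
  then have "(\<lambda>n. (2 * pi * local_prob (s n) (j n) (m n) (M n)) / (2 * pi)) \<longlonglongrightarrow> (2 * pi * local_const) / (2 * pi)"
    by (intro tendsto_divide) auto
  then show "(\<lambda>n. local_prob (s n) (j n) (m n) (M n)) \<longlonglongrightarrow> local_const" by simp
qed

section \<open>Rescaled positions and tail products\<close>

text \<open>The tilting parameter: parts are weighted by \<open>exp (- tilt n / 2)\<close> per unit, which makes \<open>n\<close> the typical
size. Even parts are halved in the encoding, hence the factor \<open>2\<close> against \<open>pi / sqrt (6 * n)\<close>.\<close>

definition tilt :: "nat \<Rightarrow> real" where "tilt n = 2 * pi / sqrt (6 * real n)"

text \<open>The rescaled position of \<open>j\<close>. As \<open>alpha n = - ln (tilt n) / 2\<close>, it is \<open>exp (- u)\<close> for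
\<open>u = pi / sqrt (6 * n) * j - alpha n\<close>; it decreases in \<open>j\<close>.\<close>

definition rpos :: "real \<Rightarrow> nat \<Rightarrow> real" where "rpos s j = s powr (- 1 / 2) * exp (- (s * real j / 2))"

text \<open>The part beyond \<open>j\<close> of the Euler product, cut off at \<open>n\<close>. The cut is harmless because a partition of
\<open>n\<close> has at most \<open>n\<close> odd and at most \<open>n\<close> even parts.\<close>

definition tail_prod :: "real \<Rightarrow> nat \<Rightarrow> nat \<Rightarrow> real" where
  "tail_prod s n j = (\<Prod>k\<in>{j<..n}. 1 - exp (- s * real k))"

lemma tilt_pos: "n > 0 \<Longrightarrow> tilt n > 0" by (simp add: tilt_def)

lemma tilt_ev_pos: "\<forall>\<^sub>F n in sequentially. tilt n > 0"
  using eventually_gt_at_top[of 0] by eventually_elim (rule tilt_pos)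

lemma tilt_lim: "tilt \<longlonglongrightarrow> 0"
proof -
  have "filterlim (\<lambda>n. sqrt (6 * real n)) at_top sequentially"
    by (intro filterlim_compose[OF sqrt_at_top] filterlim_tendsto_pos_mult_at_top[OF tendsto_const] filterlim_real_sequentially) simp
  then show ?thesis unfolding tilt_def[abs_def]
    by (intro tendsto_divide_0[OF tendsto_const] filterlim_at_top_imp_at_infinity)
qed

lemma tilt_sq: "n > 0 \<Longrightarrow> (tilt n)\<^sup>2 * real n = 2 * pi\<^sup>2 / 3"
  by (simp add: tilt_def power_divide power_mult_distrib field_simps)

lemma tilt_sq_ge: assumes "n > 0" shows "real n * (tilt n)\<^sup>2 \<ge> 1"
proof -
  have "3 \<le> pi" using pi_approx by simp
  then have "3\<^sup>2 \<le> pi\<^sup>2" by (intro power_mono) auto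
  then show ?thesis using tilt_sq[OF assms] by (simp add: mult.commute)
qed

lemma alpha_eq: assumes "n > 0" shows "alpha n = - ln (tilt n) / 2"
proof -
  have "tilt n = (2 * pi / sqrt 6) / sqrt (real n)" using assms by (simp add: tilt_def real_sqrt_mult)
  then have "ln (tilt n) = ln (2 * pi / sqrt 6) - ln (real n) / 2"
    using assms by (simp add: ln_div ln_mult ln_sqrt)
  then show ?thesis by (simp add: alpha_def)
qed

lemma rpos_pos: "s > 0 \<Longrightarrow> rpos s j > 0" by (simp add: rpos_def)

lemma rpos_sq: "s > 0 \<Longrightarrow> (rpos s j)\<^sup>2 = exp (- s * real j) / s"
proof -
  assume s: "s > 0"
  have "(s powr (- 1 / 2))\<^sup>2 = s powr (-1)" unfolding power2_eq_square by (subst powr_add[symmetric]) simp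
  then have 1: "(s powr (- 1 / 2))\<^sup>2 = 1 / s" using s by (simp only: powr_minus_divide powr_one)
  have 2: "(exp (- (s * real j / 2)))\<^sup>2 = exp (- s * real j)" by (simp add: power2_eq_square flip: exp_add)
  show ?thesis unfolding rpos_def power_mult_distrib 1 2 by simp
qed

lemma rpos_ge_iff:
  assumes "s > 0" "z > 0"
  shows "z \<le> rpos s j \<longleftrightarrow> real j \<le> 2 / s * (- ln s / 2 - ln z)"
proof -
  have l: "ln (rpos s j) = - ln s / 2 - s * real j / 2" using assms by (simp add: rpos_def ln_mult ln_powr)
  have "z \<le> rpos s j \<longleftrightarrow> ln z \<le> ln (rpos s j)" using assms rpos_pos[of s j] by simp
  moreover have "real j \<le> 2 / s * (- ln s / 2 - ln z) \<longleftrightarrow> s * real j \<le> 2 * (- ln s / 2 - ln z)"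
    using assms by (simp add: pos_le_divide_eq mult.commute)
  moreover have "(c \<le> - b / 2 - a / 2) = (a \<le> 2 * (- b / 2 - c))" for a b c :: real by auto
  ultimately show ?thesis unfolding l by metis
qed

lemma rpos_less_iff:
  assumes "s > 0" "z > 0"
  shows "rpos s j < z \<longleftrightarrow> 2 / s * (- ln s / 2 - ln z) < real j"
  using rpos_ge_iff[OF assms, of j] by linarith

lemma rpos_add2: "rpos s (j + 2) = rpos s j * exp (- s)"
  by (simp add: rpos_def algebra_simps flip: exp_add)

lemma rpos_Suc: "rpos s (Suc j) = rpos s j * exp (- (s / 2))"
  by (simp add: rpos_def algebra_simps add_divide_distrib flip: exp_add)

lemma exp_tilt_n:
  assumes n: "n > 0"
  shows "exp (- tilt n * real n) \<le> tilt n" "exp (- tilt n * real n) / tilt n \<le> 2 * tilt n"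
proof -
  define x where "x = tilt n * real n"
  have s: "tilt n > 0" by (rule tilt_pos[OF n])
  have x: "x > 0" using s n by (simp add: x_def)
  have xs: "x * tilt n \<ge> 1" using tilt_sq_ge[OF n] by (simp add: x_def power2_eq_square mult_ac)
  have "x * exp (- x) \<le> exp x * exp (- x)" using le_exp_self[of x] x by (intro mult_right_mono) auto
  then have xe: "x * exp (- x) \<le> 1" by (simp flip: exp_add)
  have "1 * exp (- x) \<le> (x * tilt n) * exp (- x)" using xs by (intro mult_right_mono) auto
  also have "\<dots> = tilt n * (x * exp (- x))" by simp
  also have "\<dots> \<le> tilt n * 1" using xe s by (intro mult_left_mono) auto
  finally show "exp (- tilt n * real n) \<le> tilt n" by (simp add: x_def)
  have "x\<^sup>2 / 2 \<le> exp x" using exp_lower_Taylor_quadratic[of x] x by linarith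
  then have "x\<^sup>2 / 2 * exp (- x) \<le> exp x * exp (- x)" by (intro mult_right_mono) auto
  then have xe2: "x\<^sup>2 * exp (- x) \<le> 2" by (simp flip: exp_add)
  have "1\<^sup>2 \<le> (x * tilt n)\<^sup>2" using xs by (intro power_mono) auto
  then have "1 * exp (- x) \<le> (x * tilt n)\<^sup>2 * exp (- x)" by (intro mult_right_mono) auto
  also have "\<dots> = (tilt n)\<^sup>2 * (x\<^sup>2 * exp (- x))" by (simp add: power_mult_distrib)
  also have "\<dots> \<le> (tilt n)\<^sup>2 * 2" using xe2 by (intro mult_left_mono) auto
  finally have "exp (- x) / tilt n \<le> 2 * tilt n" using s by (simp add: field_simps power2_eq_square)
  then show "exp (- tilt n * real n) / tilt n \<le> 2 * tilt n" by (simp add: x_def)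
qed

lemma sum_exp_tail:
  fixes s :: real
  assumes "s > 0" "j \<le> n"
  shows "(\<Sum>k\<in>{j<..n}. exp (- s * real k)) = (exp (- s * real j) - exp (- s * real n)) / (exp s - 1)"
proof -
  have "(\<Sum>k\<in>{j<..n}. exp (- s * real k)) * (exp s - 1) = exp (- s * real j) - exp (- s * real n)"
    using assms(2)
  proof (induction n rule: dec_induct)
    case (step n)
    have "{j<..Suc n} = insert (Suc n) {j<..n}" using step.hyps by auto
    then show ?case using step.IH by (simp add: algebra_simps flip: exp_add)
  qed simp
  then show ?thesis using assms(1) by (simp add: field_simps)
qed

lemma tail_prod_nonneg: "s > 0 \<Longrightarrow> 0 \<le> tail_prod s n j"
  unfolding tail_prod_def by (intro prod_nonneg) auto

lemma tail_prod_le_1: "s > 0 \<Longrightarrow> tail_prod s n j \<le> 1"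
  unfolding tail_prod_def by (intro prod_le_1) auto

lemma tail_prod_le_exp:
  assumes "s > 0"
  shows "tail_prod s n j \<le> exp (- (\<Sum>k\<in>{j<..n}. exp (- s * real k)))"
proof -
  have "tail_prod s n j \<le> (\<Prod>k\<in>{j<..n}. exp (- exp (- s * real k)))"
    unfolding tail_prod_def
  proof (rule prod_mono, intro conjI)
    fix k assume "k \<in> {j<..n}"
    show "0 \<le> 1 - exp (- s * real k)" using assms by simp
    show "1 - exp (- s * real k) \<le> exp (- exp (- s * real k))"
      using exp_ge_add_one_self[of "- exp (- s * real k)"] by simp
  qed
  then show ?thesis by (simp add: exp_sum flip: sum_negf)
qed

lemma tail_prod_le_gauss:
  assumes s: "0 < s" "s \<le> 1" and n: "exp (- s * real n) / s \<le> 1" and j: "j \<le> n"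
  shows "tail_prod s n j \<le> 2 * exp (- ((rpos s j)\<^sup>2 / 2))"
proof -
  have "s * s \<le> 1 * s" using s by (intro mult_right_mono) auto
  then have e: "exp s - 1 \<le> 2 * s" using exp_bound[of s] s unfolding power2_eq_square by linarith
  have e0: "exp s - 1 > 0" using s by simp
  have d: "exp (- s * real j) - exp (- s * real n) \<ge> 0" using s j by (simp add: mult_left_mono)
  have "(rpos s j)\<^sup>2 / 2 - 1/2 \<le> (exp (- s * real j) - exp (- s * real n)) / (2 * s)"
  proof -
    have "(a - b) / (2 * s) = a / s / 2 - b / s / 2" for a b by (simp add: diff_divide_distrib)
    then show ?thesis unfolding rpos_sq[OF s(1)] using n by simp
  qed
  also have "\<dots> \<le> (exp (- s * real j) - exp (- s * real n)) / (exp s - 1)"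
    using e e0 d s by (intro divide_left_mono) auto
  also have "\<dots> = (\<Sum>k\<in>{j<..n}. exp (- s * real k))" using sum_exp_tail[OF s(1) j] ..
  finally have q: "(rpos s j)\<^sup>2 / 2 - 1/2 \<le> (\<Sum>k\<in>{j<..n}. exp (- s * real k))" .
  have "tail_prod s n j \<le> exp (- (\<Sum>k\<in>{j<..n}. exp (- s * real k)))" by (rule tail_prod_le_exp[OF s(1)])
  also have "\<dots> \<le> exp (- ((rpos s j)\<^sup>2 / 2 - 1/2))" using q by (simp only: exp_le_cancel_iff neg_le_iff_le)
  also have "\<dots> = exp (1/2) * exp (- ((rpos s j)\<^sup>2 / 2))" by (simp flip: exp_add)
  also have "\<dots> \<le> 2 * exp (- ((rpos s j)\<^sup>2 / 2))"
    using exp_bound[of "1/2::real"] by (intro mult_right_mono) (auto simp: power2_eq_square)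
  finally show ?thesis .
qed

lemma tail_prod_limit:
  assumes z: "(\<lambda>n. rpos (tilt n) (j n)) \<longlonglongrightarrow> \<zeta>" and j: "\<forall>\<^sub>F n in sequentially. j n \<le> n"
  shows "(\<lambda>n. tail_prod (tilt n) n (j n)) \<longlonglongrightarrow> exp (- (\<zeta>\<^sup>2))"
proof -
  define \<sigma> where "\<sigma> = (\<lambda>n. \<Sum>k\<in>{j n<..n}. exp (- tilt n * real k))"
  have e1: "(\<lambda>n. tilt n / (exp (tilt n) - 1)) \<longlonglongrightarrow> 1"
  proof -
    have "((\<lambda>x::real. x / (exp x - 1)) \<longlongrightarrow> 1) (at_right 0)" by real_asymp
    moreover have "filterlim tilt (at_right 0) sequentially"
      using tilt_lim tilt_ev_pos by (simp add: filterlim_at eventually_mono)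
    ultimately show ?thesis by (rule filterlim_compose)
  qed
  have e2: "(\<lambda>n. exp (- tilt n * real n) / tilt n) \<longlonglongrightarrow> 0"
  proof (rule tendsto_sandwich[OF _ _ tendsto_const])
    show "\<forall>\<^sub>F n in sequentially. 0 \<le> exp (- tilt n * real n) / tilt n" using tilt_ev_pos by eventually_elim simp
    show "\<forall>\<^sub>F n in sequentially. exp (- tilt n * real n) / tilt n \<le> 2 * tilt n"
      using eventually_gt_at_top[of 0] by eventually_elim (rule exp_tilt_n)
    show "(\<lambda>n. 2 * tilt n) \<longlonglongrightarrow> 0" using tendsto_mult[OF tendsto_const tilt_lim, of 2] by simp
  qed
  have "(\<lambda>n. ((rpos (tilt n) (j n))\<^sup>2 - exp (- tilt n * real n) / tilt n) * (tilt n / (exp (tilt n) - 1))) \<longlonglongrightarrow> (\<zeta>\<^sup>2 - 0) * 1"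
    by (intro tendsto_intros z e1 e2)
  moreover have "\<forall>\<^sub>F n in sequentially. ((rpos (tilt n) (j n))\<^sup>2 - exp (- tilt n * real n) / tilt n) * (tilt n / (exp (tilt n) - 1)) = \<sigma> n"
    using tilt_ev_pos j
  proof eventually_elim
    case (elim n)
    show ?case unfolding \<sigma>_def sum_exp_tail[OF elim] rpos_sq[OF elim(1)] using elim(1) by (simp add: field_simps)
  qed
  ultimately have sg: "\<sigma> \<longlonglongrightarrow> \<zeta>\<^sup>2" using Lim_transform_eventually by fastforce
  have up: "\<forall>\<^sub>F n in sequentially. tail_prod (tilt n) n (j n) \<le> exp (- \<sigma> n)"
    using tilt_ev_pos by eventually_elim (simp only: \<sigma>_def tail_prod_le_exp)
  \<comment> \<open>From \<open>ln (1 - x) \<ge> - x - 2 * x\<^sup>2\<close>; the quadratic terms vanish because each \<open>x\<close> is at most \<open>exp (- tilt n * j n)\<close>.\<close>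
  have small: "(\<lambda>n. tilt n * (rpos (tilt n) (j n))\<^sup>2) \<longlonglongrightarrow> 0 * \<zeta>\<^sup>2" by (intro tendsto_intros tilt_lim z)
  have "\<forall>\<^sub>F n in sequentially. tilt n * (rpos (tilt n) (j n))\<^sup>2 < 1/2" by (rule order_tendstoD(2)[OF small]) simp
  then have lo: "\<forall>\<^sub>F n in sequentially. exp (- \<sigma> n - 2 * (tilt n * (rpos (tilt n) (j n))\<^sup>2 * \<sigma> n)) \<le> tail_prod (tilt n) n (j n)"
    using tilt_ev_pos
  proof eventually_elim
    case (elim n)
    let ?s = "tilt n"
    have ej: "exp (- ?s * real (j n)) = ?s * (rpos ?s (j n))\<^sup>2" using rpos_sq[OF elim(2)] elim(2) by simp
    have "exp (- \<sigma> n - 2 * (?s * (rpos ?s (j n))\<^sup>2 * \<sigma> n)) = (\<Prod>k\<in>{j n<..n}. exp (- exp (- ?s * real k) - 2 * (exp (- ?s * real (j n)) * exp (- ?s * real k))))"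
      unfolding ej[symmetric] \<sigma>_def by (simp add: exp_sum[symmetric] sum_subtractf sum_negf sum_distrib_left)
    also have "\<dots> \<le> tail_prod ?s n (j n)"
      unfolding tail_prod_def
    proof (rule prod_mono, intro conjI)
      fix k assume k: "k \<in> {j n<..n}"
      define x where "x = exp (- ?s * real k)"
      have xj: "x \<le> exp (- ?s * real (j n))" using k elim by (simp add: x_def)
      have x: "0 < x" by (simp add: x_def)
      have "x \<le> 1/2" using xj ej elim by linarith
      have "- x - 2 * x\<^sup>2 \<le> ln (1 - x)" using x \<open>x \<le> 1/2\<close> by (intro ln_one_minus_pos_lower_bound) auto
      moreover have "x\<^sup>2 \<le> exp (- ?s * real (j n)) * x" unfolding power2_eq_square using xj x by (intro mult_right_mono) auto
      ultimately have "- x - 2 * (exp (- ?s * real (j n)) * x) \<le> ln (1 - x)" by linarith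
      then have "exp (- x - 2 * (exp (- ?s * real (j n)) * x)) \<le> exp (ln (1 - x))" by simp
      also have "exp (ln (1 - x)) = 1 - x" using \<open>x \<le> 1/2\<close> by simp
      finally show "exp (- exp (- ?s * real k) - 2 * (exp (- ?s * real (j n)) * exp (- ?s * real k))) \<le> 1 - exp (- ?s * real k)"
        unfolding x_def .
    qed simp
    finally show ?case .
  qed
  show ?thesis
  proof (rule tendsto_sandwich[OF lo up])
    have "(\<lambda>n. exp (- \<sigma> n - 2 * (tilt n * (rpos (tilt n) (j n))\<^sup>2 * \<sigma> n))) \<longlonglongrightarrow> exp (- \<zeta>\<^sup>2 - 2 * (0 * \<zeta>\<^sup>2 * \<zeta>\<^sup>2))"
      by (intro tendsto_intros sg tilt_lim z)
    then show "(\<lambda>n. exp (- \<sigma> n - 2 * (tilt n * (rpos (tilt n) (j n))\<^sup>2 * \<sigma> n))) \<longlonglongrightarrow> exp (- (\<zeta>\<^sup>2))" by simp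
    show "(\<lambda>n. exp (- \<sigma> n)) \<longlonglongrightarrow> exp (- (\<zeta>\<^sup>2))" by (intro tendsto_intros sg)
  qed
qed

text \<open>Consequences for indices \<open>j n\<close> whose rescaled position stays next to a fixed \<open>z > 0\<close>.\<close>

lemma index_facts:
  assumes z: "z > 0" and j: "\<forall>\<^sub>F n in sequentially. z \<le> rpos (tilt n) (j n) \<and> rpos (tilt n) (j n) \<le> z * exp (tilt n)"
  shows "(\<lambda>n. rpos (tilt n) (j n)) \<longlonglongrightarrow> z"
    "\<forall>\<^sub>F n in sequentially. exp (- tilt n * real (j n)) \<le> (9 * z\<^sup>2) * tilt n"
    "(\<lambda>n. tilt n powr (3/2) * real (j n)) \<longlonglongrightarrow> 0"
    "\<forall>\<^sub>F n in sequentially. j n \<le> n"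
proof -
  show "(\<lambda>n. rpos (tilt n) (j n)) \<longlonglongrightarrow> z"
  proof (rule tendsto_sandwich[OF _ _ tendsto_const])
    show "\<forall>\<^sub>F n in sequentially. z \<le> rpos (tilt n) (j n)" using j by eventually_elim simp
    show "\<forall>\<^sub>F n in sequentially. rpos (tilt n) (j n) \<le> z * exp (tilt n)" using j by eventually_elim simp
    have "(\<lambda>n. z * exp (tilt n)) \<longlonglongrightarrow> z * exp 0" by (intro tendsto_intros tilt_lim)
    then show "(\<lambda>n. z * exp (tilt n)) \<longlonglongrightarrow> z" by simp
  qed
  have s1: "\<forall>\<^sub>F n in sequentially. tilt n < 1" by (rule order_tendstoD(2)[OF tilt_lim]) simp
  show "\<forall>\<^sub>F n in sequentially. exp (- tilt n * real (j n)) \<le> (9 * z\<^sup>2) * tilt n"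
    using j tilt_ev_pos s1
  proof eventually_elim
    case (elim n)
    have "exp (tilt n) \<le> 3" using elim exp_le by (meson exp_le_cancel_iff less_imp_le order_trans)
    then have "z * exp (tilt n) \<le> z * 3" using z by (intro mult_left_mono) auto
    then have "(rpos (tilt n) (j n))\<^sup>2 \<le> (z * 3)\<^sup>2" using elim rpos_pos[of "tilt n" "j n"] by (intro power_mono) auto
    then show ?case using rpos_sq[OF elim(2), of "j n"] elim(2) by (simp add: power_mult_distrib field_simps)
  qed
  show j0: "(\<lambda>n. tilt n powr (3/2) * real (j n)) \<longlonglongrightarrow> 0"
  proof (rule tendsto_sandwich[OF _ _ tendsto_const])
    show "\<forall>\<^sub>F n in sequentially. 0 \<le> tilt n powr (3/2) * real (j n)" by simp
    show "\<forall>\<^sub>F n in sequentially. tilt n powr (3/2) * real (j n) \<le> tilt n powr (1/2) * (- ln (tilt n) - 2 * ln z)"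
      using j tilt_ev_pos
    proof eventually_elim
      case (elim n)
      have "real (j n) \<le> 2 / tilt n * (- ln (tilt n) / 2 - ln z)" using elim rpos_ge_iff[OF elim(2) z, of "j n"] by simp
      then have "tilt n powr (3/2) * real (j n) \<le> tilt n powr (3/2) * (2 / tilt n * (- ln (tilt n) / 2 - ln z))" by (intro mult_left_mono) auto
      also have "\<dots> = (tilt n powr (3/2) * tilt n powr (-1)) * (- ln (tilt n) - 2 * ln z)"
        using elim(2) by (simp add: powr_minus_divide field_simps)
      also have "tilt n powr (3/2) * tilt n powr (-1) = tilt n powr (1/2)" by (subst powr_add[symmetric]) simp
      finally show ?case .
    qed
    have "((\<lambda>x::real. x powr (1/2) * (- ln x - 2 * ln z)) \<longlongrightarrow> 0) (at_right 0)" by real_asymp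
    moreover have "filterlim tilt (at_right 0) sequentially"
      using tilt_lim tilt_ev_pos by (simp add: filterlim_at eventually_mono)
    ultimately show "(\<lambda>n. tilt n powr (1/2) * (- ln (tilt n) - 2 * ln z)) \<longlonglongrightarrow> 0" by (rule filterlim_compose)
  qed
  have "\<forall>\<^sub>F n in sequentially. tilt n powr (3/2) * real (j n) < 1" by (rule order_tendstoD(2)[OF j0]) simp
  then show "\<forall>\<^sub>F n in sequentially. j n \<le> n"
    using tilt_ev_pos s1 eventually_gt_at_top[of 0]
  proof eventually_elim
    case (elim n)
    have "(tilt n)\<^sup>2 = tilt n powr 2" using elim by (simp add: powr_realpow)
    also have "\<dots> \<le> tilt n powr (3/2)" using elim by (intro powr_mono') auto
    finally have "(tilt n)\<^sup>2 * real (j n) \<le> tilt n powr (3/2) * real (j n)" by (intro mult_right_mono) auto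
    also have "\<dots> < 1" using elim by simp
    also have "1 \<le> (tilt n)\<^sup>2 * real n" using tilt_sq_ge[OF elim(4)] by (simp add: mult.commute)
    finally show ?case using elim by (simp add: mult_less_cancel_left_pos)
  qed
qed

section \<open>The joint limit law\<close>

lemma odd_even_parts_le:
  assumes "lam \<in> partitions n" shows "odd_parts lam \<le> n" "even_parts lam \<le> n"
proof -
  have "size lam \<le> n" using assms size_le_sum_mset[of lam] by (simp add: partitions_def)
  then show "odd_parts lam \<le> n" "even_parts lam \<le> n"
    unfolding odd_parts_eq even_parts_eq by (meson order_trans size_filter_mset_lesseq)+
qed

text \<open>The common factor of all the counts, which cancels in the quotient.\<close>

definition common_weight :: "nat \<Rightarrow> real" where
  "common_weight n = (tilt n)\<^sup>2 * exp (tilt n * real n / 2) / ((tail_prod (tilt n) n 0)\<^sup>2 * (1 - exp (- tilt n)))"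

lemma tail_prod_pos: "s > 0 \<Longrightarrow> 0 < tail_prod s n j"
  unfolding tail_prod_def by (intro prod_pos) auto

lemma common_weight_pos: "n > 0 \<Longrightarrow> common_weight n > 0"
  unfolding common_weight_def using tilt_pos[of n] tail_prod_pos[of "tilt n" n 0] by (intro divide_pos_pos mult_pos_pos) auto

lemma count_pairs_eq:
  assumes n: "n > 0" and j: "j \<le> n" "even (n - j)" and m: "m \<le> n"
  defines "s \<equiv> tilt n"
  shows "real (count_pairs j m ((n - j) div 2)) =
    common_weight n * ((rpos s j - rpos s (j + 2)) * (tail_prod s n j * tail_prod s n m * local_prob s j m ((n - j) div 2)))"
proof -
  have s: "s > 0" unfolding s_def by (rule tilt_pos[OF n])
  let ?P = "\<lambda>j. \<Prod>k\<in>{1..j}. 1 - exp (- s * real k)"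
  have P0: "?P j \<noteq> 0" for j using s by simp
  have PT: "?P j * tail_prod s n j = tail_prod s n 0" if "j \<le> n" for j
  proof -
    have "{0<..n} = {1..j} \<union> {j<..n}" "{1..j} \<inter> {j<..n} = {}" using that by auto
    then show ?thesis unfolding tail_prod_def by (simp add: prod.union_disjoint)
  qed
  define M where "M = (n - j) div 2"
  have "2 * M + j = n" using j by (simp add: M_def)
  then have M: "real M = real n / 2 - real j / 2" by linarith
  have es: "1 - exp (- s) \<noteq> 0" using s by simp
  have zd: "rpos s j - rpos s (j + 2) = s powr (- 1 / 2) * exp (- (s * real j / 2)) * (1 - exp (- s))"
    unfolding rpos_add2 by (simp add: rpos_def algebra_simps)
  have t: "tail_prod s n j = tail_prod s n 0 / ?P j" "tail_prod s n m = tail_prod s n 0 / ?P m"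
    using PT[OF j(1)] PT[OF m] P0[of j] P0[of m] by (simp_all add: field_simps)
  have T0: "tail_prod s n 0 \<noteq> 0" using tail_prod_pos[OF s, of n 0] by simp
  have "common_weight n * ((rpos s j - rpos s (j + 2)) * (tail_prod s n j * tail_prod s n m * local_prob s j m M)) =
    (s\<^sup>2 * s powr (- 1 / 2) * s powr (- 3 / 2)) * (exp (s * real n / 2) * exp (- (s * real j / 2)) * exp (- s * M)) * real (count_pairs j m M)"
    unfolding common_weight_def zd t local_prob_def s_def[symmetric] using P0[of j] P0[of m] T0 es
    by (simp add: power2_eq_square)
  also have "s\<^sup>2 * s powr (- 1 / 2) * s powr (- 3 / 2) = 1"
  proof -
    have "s powr (- 1 / 2) * s powr (- 3 / 2) = s powr (-2)" by (subst powr_add[symmetric]) simp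
    then show ?thesis using s by (simp add: powr_minus_divide powr_realpow mult.assoc)
  qed
  also have "exp (s * real n / 2) * exp (- (s * real j / 2)) * exp (- s * M) = 1"
    unfolding exp_add[symmetric] M by (simp add: algebra_simps)
  finally show ?thesis by (simp add: M_def)
qed

text \<open>The height of the step belonging to \<open>j\<close> odd parts and at most \<open>m\<close> even parts; the parameter \<open>X\<close>
restricts \<open>j\<close> to rescaled positions at least \<open>X\<close>.\<close>

definition step_height :: "nat \<Rightarrow> real \<Rightarrow> nat \<Rightarrow> nat \<Rightarrow> real" where
  "step_height n X m j = (if X \<le> rpos (tilt n) j then tail_prod (tilt n) n j * tail_prod (tilt n) n m * local_prob (tilt n) j m ((n - j) div 2) else 0)"

text \<open>The number of odd parts has the parity of \<open>n\<close>, so \<open>j\<close> runs through \<open>n mod 2 + 2 * i\<close> and the step of \<open>j\<close>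
extends from the position of \<open>j + 2\<close> to that of \<open>j\<close>.\<close>

definition step_fun :: "nat \<Rightarrow> real \<Rightarrow> nat \<Rightarrow> real \<Rightarrow> real" where
  "step_fun n X m z = (\<Sum>i\<le>n div 2. indicator {rpos (tilt n) (n mod 2 + 2 * i + 2)<..rpos (tilt n) (n mod 2 + 2 * i)} z * step_height n X m (n mod 2 + 2 * i))"

lemma rpos_mono2: "s > 0 \<Longrightarrow> rpos s (j + 2) \<le> rpos s j"
  unfolding rpos_add2 using rpos_pos[of s j] by (simp add: mult_le_cancel_left1)

lemma step_fun_measurable [measurable]: "step_fun n X m \<in> borel_measurable borel"
  unfolding step_fun_def by measurable

lemma integral_step_fun:
  assumes n: "n > 0"
  shows "integral\<^sup>L lborel (step_fun n X m) = (\<Sum>i\<le>n div 2. (rpos (tilt n) (n mod 2 + 2 * i) - rpos (tilt n) (n mod 2 + 2 * i + 2)) * step_height n X m (n mod 2 + 2 * i))"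
proof -
  let ?I = "\<lambda>i. {rpos (tilt n) (n mod 2 + 2 * i + 2)<..rpos (tilt n) (n mod 2 + 2 * i)}"
  have le: "rpos (tilt n) (n mod 2 + 2 * i + 2) \<le> rpos (tilt n) (n mod 2 + 2 * i)" for i by (rule rpos_mono2[OF tilt_pos[OF n]])
  have int: "integrable lborel (\<lambda>z. indicator (?I i) z * step_height n X m (n mod 2 + 2 * i))" for i
    using le by (intro integrable_mult_left integrable_real_indicator) auto
  have "integral\<^sup>L lborel (step_fun n X m) = (\<Sum>i\<le>n div 2. \<integral>z. indicator (?I i) z * step_height n X m (n mod 2 + 2 * i) \<partial>lborel)"
    unfolding step_fun_def by (rule Bochner_Integration.integral_sum[OF int])
  also have "\<dots> = (\<Sum>i\<le>n div 2. measure lborel (?I i) * step_height n X m (n mod 2 + 2 * i))"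
    by simp
  finally show ?thesis using le by simp
qed

lemma sum_even_diff:
  fixes n :: nat and f :: "nat \<Rightarrow> real"
  shows "(\<Sum>j\<le>n. if even (n - j) then f j else 0) = (\<Sum>i\<le>n div 2. f (n mod 2 + 2 * i))"
proof -
  have "(\<Sum>j\<le>n. if even (n - j) then f j else 0) = sum f {j. j \<le> n \<and> even (n - j)}"
    by (rule sum.mono_neutral_cong_right) auto
  also have "\<dots> = (\<Sum>i\<le>n div 2. f (n mod 2 + 2 * i))"
  proof (rule sum.reindex_bij_witness[of _ "\<lambda>i. n mod 2 + 2 * i" "\<lambda>j. j div 2"])
    fix j assume j: "j \<in> {j. j \<le> n \<and> even (n - j)}"
    have "j \<le> n \<Longrightarrow> even (n - j) \<Longrightarrow> n mod 2 + 2 * (j div 2) = j" by presburger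
    with j show *: "n mod 2 + 2 * (j div 2) = j" by blast
    show "j div 2 \<in> {..n div 2}" using j by (auto intro: div_le_mono)
    show "f (n mod 2 + 2 * (j div 2)) = f j" unfolding * ..
  next
    fix i assume i: "i \<in> {..n div 2}"
    show "(n mod 2 + 2 * i) div 2 = i" by simp
    have "n = n mod 2 + 2 * (n div 2)" by (rule mod_mult_div_eq[symmetric])
    moreover have "i \<le> n div 2" using i by (rule atMost_iff[THEN iffD1])
    moreover have "p + 2 * i \<le> n \<and> n - (p + 2 * i) = 2 * (q - i)" if "n = p + 2 * q" "i \<le> q" for p q
      using that by linarith
    ultimately have "n mod 2 + 2 * i \<le> n \<and> n - (n mod 2 + 2 * i) = 2 * (n div 2 - i)" by blast
    then show "n mod 2 + 2 * i \<in> {j. j \<le> n \<and> even (n - j)}" by (metis dvd_triv_left mem_Collect_eq)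
  qed
  finally show ?thesis .
qed

lemma card_eq_integral:
  assumes n: "n > 0" and m: "m \<le> n"
  shows "real (card {lam \<in> partitions n. X \<le> rpos (tilt n) (odd_parts lam) \<and> even_parts lam \<le> m}) = common_weight n * integral\<^sup>L lborel (step_fun n X m)"
proof -
  let ?S = "\<lambda>j. {lam \<in> partitions n. odd_parts lam = j \<and> even_parts lam \<le> m}"
  let ?J = "{j. j \<le> n \<and> X \<le> rpos (tilt n) j}"
  have "{lam \<in> partitions n. X \<le> rpos (tilt n) (odd_parts lam) \<and> even_parts lam \<le> m} = (\<Union>j\<in>?J. ?S j)"
    using odd_even_parts_le by auto
  also have "card \<dots> = (\<Sum>j\<in>?J. card (?S j))"
    by (rule card_UN_disjoint) (auto intro: finite_subset[OF _ finite_partitions])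
  finally have "real (card {lam \<in> partitions n. X \<le> rpos (tilt n) (odd_parts lam) \<and> even_parts lam \<le> m}) = (\<Sum>j\<in>?J. real (card (?S j)))" by simp
  also have "\<dots> = (\<Sum>j\<le>n. if even (n - j) then common_weight n * ((rpos (tilt n) j - rpos (tilt n) (j + 2)) * step_height n X m j) else 0)"
  proof (rule sum.mono_neutral_cong_left)
    show "\<forall>j\<in>{..n} - ?J. (if even (n - j) then common_weight n * ((rpos (tilt n) j - rpos (tilt n) (j + 2)) * step_height n X m j) else 0) = 0"
      by (auto simp: step_height_def)
    fix j assume "j \<in> ?J"
    then show "real (card (?S j)) = (if even (n - j) then common_weight n * ((rpos (tilt n) j - rpos (tilt n) (j + 2)) * step_height n X m j) else 0)"
      unfolding card_partitions_odd_even using count_pairs_eq[OF n _ _ m, of j] by (auto simp: step_height_def)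
  qed auto
  also have "\<dots> = common_weight n * integral\<^sup>L lborel (step_fun n X m)"
    unfolding sum_even_diff integral_step_fun[OF n] by (simp add: sum_distrib_left)
  finally show ?thesis .
qed

text \<open>The real index whose rescaled position is \<open>z\<close>.\<close>

definition index_of :: "real \<Rightarrow> real \<Rightarrow> real" where "index_of s z = 2 / s * (- ln s / 2 - ln z)"

lemma step_fun_eq:
  assumes n: "n > 0" and z: "z > 0"
  defines "i \<equiv> nat \<lfloor>(index_of (tilt n) z - real (n mod 2)) / 2\<rfloor>"
  shows "step_fun n X m z = (if real (n mod 2) \<le> index_of (tilt n) z \<and> i \<le> n div 2 then step_height n X m (n mod 2 + 2 * i) else 0)"
proof -
  define p where "p = n mod 2"
  define r where "r = index_of (tilt n) z"
  have s: "tilt n > 0" by (rule tilt_pos[OF n])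
  have iff: "z \<in> {rpos (tilt n) (p + 2 * k + 2)<..rpos (tilt n) (p + 2 * k)} \<longleftrightarrow> real p \<le> r \<and> k = i" for k
  proof -
    have "z \<in> {rpos (tilt n) (p + 2 * k + 2)<..rpos (tilt n) (p + 2 * k)} \<longleftrightarrow> r < real (p + 2 * k + 2) \<and> real (p + 2 * k) \<le> r"
      unfolding greaterThanAtMost_iff rpos_ge_iff[OF s z] rpos_less_iff[OF s z] r_def index_of_def ..
    also have "\<dots> \<longleftrightarrow> \<lfloor>(r - real p) / 2\<rfloor> = int k" by (auto simp: floor_eq_iff field_simps)
    also have "\<dots> \<longleftrightarrow> real p \<le> r \<and> k = i"
      unfolding i_def r_def[symmetric] p_def[symmetric]
    proof
      assume "\<lfloor>(r - real p) / 2\<rfloor> = int k"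
      moreover from this have "real p \<le> r" by (auto simp: floor_eq_iff)
      ultimately show "real p \<le> r \<and> k = nat \<lfloor>(r - real p) / 2\<rfloor>" by simp
    next
      assume "real p \<le> r \<and> k = nat \<lfloor>(r - real p) / 2\<rfloor>"
      then show "\<lfloor>(r - real p) / 2\<rfloor> = int k" by simp
    qed
    finally show ?thesis .
  qed
  have "step_fun n X m z = (\<Sum>k\<le>n div 2. if k = i then (if real p \<le> r then step_height n X m (p + 2 * i) else 0) else 0)"
    unfolding step_fun_def p_def[symmetric] 
  proof (rule sum.cong[OF refl])
    fix k
    show "indicator {rpos (tilt n) (p + 2 * k + 2)<..rpos (tilt n) (p + 2 * k)} z * step_height n X m (p + 2 * k) =
      (if k = i then (if real p \<le> r then step_height n X m (p + 2 * i) else 0) else 0)"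
      unfolding indicator_def iff by auto
  qed
  then show ?thesis by (simp add: p_def r_def)
qed

lemma step_fun_nonpos: "n > 0 \<Longrightarrow> z \<le> 0 \<Longrightarrow> step_fun n X m z = 0"
  unfolding step_fun_def
proof (intro sum.neutral ballI)
  fix i assume n: "n > 0" and z: "z \<le> 0"
  have "z \<notin> {rpos (tilt n) (n mod 2 + 2 * i + 2)<..rpos (tilt n) (n mod 2 + 2 * i)}"
    using rpos_pos[OF tilt_pos[OF n], of "n mod 2 + 2 * i + 2"] z by (meson greaterThanAtMost_iff less_le_trans not_less_iff_gr_or_eq)
  then show "indicator {rpos (tilt n) (n mod 2 + 2 * i + 2)<..rpos (tilt n) (n mod 2 + 2 * i)} z * step_height n X m (n mod 2 + 2 * i) = 0"
    unfolding indicator_def by (simp only: of_bool_def if_False mult_zero_left)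
qed

lemma rpos_1_ge: assumes "z > 0" shows "\<forall>\<^sub>F n in sequentially. z \<le> rpos (tilt n) 1"
proof -
  have "filterlim (\<lambda>x::real. x powr (- 1 / 2) * exp (- (x * real 1 / 2))) at_top (at_right 0)" by real_asymp
  moreover have "filterlim tilt (at_right 0) sequentially"
    using tilt_lim tilt_ev_pos by (simp add: filterlim_at eventually_mono)
  ultimately have "filterlim (\<lambda>n. rpos (tilt n) 1) at_top sequentially" unfolding rpos_def by (rule filterlim_compose)
  then show ?thesis by (simp add: filterlim_at_top)
qed

lemma gauss_le_cauchy: "exp (- ((z::real)\<^sup>2 / 2)) \<le> 2 / (1 + z\<^sup>2)"
proof -
  have "1 + z\<^sup>2 > 0" by (simp add: add_pos_nonneg)
  moreover have "1 + z\<^sup>2 \<le> 2 * e" if "1 + z\<^sup>2 / 2 \<le> e" for e using that by linarith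
  from this[OF exp_ge_add_one_self] have "1 + z\<^sup>2 \<le> 2 * exp (z\<^sup>2 / 2)" .
  ultimately show ?thesis by (simp add: exp_minus field_simps)
qed

text \<open>At \<open>z > X\<close> the index of the step containing \<open>z\<close> satisfies the hypotheses of the local limit theorem,
and the tail product tends to \<open>exp (- z\<^sup>2)\<close>; at \<open>z < X\<close> the steps are eventually zero. The Gaussian bound
of the tail product gives the majorant.\<close>

lemma step_fun_limit:
  assumes m: "\<forall>\<^sub>F n in sequentially. m n \<le> n"
    and B: "\<forall>\<^sub>F n in sequentially. exp (- tilt n * real (m n)) \<le> B * tilt n"
    and \<tau>: "(\<lambda>n. tail_prod (tilt n) n (m n)) \<longlonglongrightarrow> \<tau>" and X: "X \<ge> 0"
  shows "local_const > 0"
    "(\<lambda>n. integral\<^sup>L lborel (step_fun n X (m n))) \<longlonglongrightarrow> local_const * \<tau> * (\<integral>z. indicator {X..} z * exp (- z\<^sup>2) \<partial>lborel)"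
proof -
  define j where "j = (\<lambda>z n. n mod 2 + 2 * nat \<lfloor>(index_of (tilt n) z - real (n mod 2)) / 2\<rfloor>)"
  have c1: "\<forall>\<^sub>F n in sequentially. 1 \<le> index_of (tilt n) z" if z: "z > 0" for z
    using rpos_1_ge[OF z] tilt_ev_pos
  proof eventually_elim
    case (elim n)
    then show ?case using rpos_ge_iff[OF elim(2) z, of 1] by (simp add: index_of_def)
  qed
  have jz: "\<forall>\<^sub>F n in sequentially. z \<le> rpos (tilt n) (j z n) \<and> rpos (tilt n) (j z n) \<le> z * exp (tilt n)" if z: "z > 0" for z
    using c1[OF z] tilt_ev_pos
  proof eventually_elim
    case (elim n)
    define q where "q = \<lfloor>(index_of (tilt n) z - real (n mod 2)) / 2\<rfloor>"
    have "real (n mod 2) \<le> 1" by (cases "even n") (auto simp: odd_iff_mod_2_eq_one)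
    then have "q \<ge> 0" using elim by (simp add: q_def)
    then have jq: "real (j z n) = real (n mod 2) + 2 * of_int q" by (simp add: j_def q_def)
    have "of_int q \<le> (index_of (tilt n) z - real (n mod 2)) / 2" "(index_of (tilt n) z - real (n mod 2)) / 2 < of_int q + 1"
      unfolding q_def by linarith+
    then have "real (j z n) \<le> index_of (tilt n) z" "index_of (tilt n) z < real (j z n + 2)" using jq by auto
    then have "z \<le> rpos (tilt n) (j z n)" "rpos (tilt n) (j z n + 2) < z"
      unfolding index_of_def rpos_ge_iff[OF elim(2) z] rpos_less_iff[OF elim(2) z] by auto
    moreover have "rpos (tilt n) (j z n) = rpos (tilt n) (j z n + 2) * exp (tilt n)"
      unfolding rpos_add2 by (simp add: mult.assoc flip: exp_add)
    ultimately show ?case by simp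
  qed
  have lltl: "local_const > 0 \<and> (\<lambda>n. local_prob (tilt n) (j z n) (m n) ((n - j z n) div 2)) \<longlonglongrightarrow> local_const" if z: "z > 0" for z
  proof -
    note jf = index_facts[OF z jz[OF z]]
    define B' where "B' = max (9 * z\<^sup>2) B"
    have b1: "\<forall>\<^sub>F n in sequentially. exp (- tilt n * real (j z n)) \<le> B' * tilt n"
      using jf(2) tilt_ev_pos
    proof eventually_elim
      case (elim n)
      have "(9 * z\<^sup>2) * tilt n \<le> B' * tilt n" using elim by (intro mult_right_mono) (auto simp: B'_def)
      then show ?case using elim by linarith
    qed
    have b2: "\<forall>\<^sub>F n in sequentially. exp (- tilt n * real (m n)) \<le> B' * tilt n"
      using B tilt_ev_pos
    proof eventually_elim
      case (elim n)
      have "B * tilt n \<le> B' * tilt n" using elim by (intro mult_right_mono) (auto simp: B'_def)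
      then show ?case using elim by linarith
    qed
    have "\<forall>\<^sub>F n in sequentially. - (tilt n powr (3/2) * real (j z n)) / 2 = tilt n powr (3/2) * (real ((n - j z n) div 2) - pi\<^sup>2 / (3 * (tilt n)\<^sup>2))"
      using jf(4) eventually_gt_at_top[of 0]
    proof eventually_elim
      case (elim n)
      have "even (n - (n mod 2 + 2 * k))" for k by presburger
      then have "even (n - j z n)" unfolding j_def .
      then have "2 * ((n - j z n) div 2) + j z n = n" using elim by simp
      then have "2 * real ((n - j z n) div 2) + real (j z n) = real n" by (metis of_nat_add of_nat_mult of_nat_numeral)
      moreover have "pi\<^sup>2 / (3 * (tilt n)\<^sup>2) = real n / 2" using tilt_sq[OF elim(2)] tilt_pos[OF elim(2)] by (simp add: field_simps)
      ultimately have "real ((n - j z n) div 2) - pi\<^sup>2 / (3 * (tilt n)\<^sup>2) = - real (j z n) / 2" by linarith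
      then show ?case by simp
    qed
    moreover have "(\<lambda>n. - (tilt n powr (3/2) * real (j z n)) / 2) \<longlonglongrightarrow> - 0 / 2" by (intro tendsto_intros jf(3)) simp
    ultimately have "(\<lambda>n. tilt n powr (3/2) * (real ((n - j z n) div 2) - pi\<^sup>2 / (3 * (tilt n)\<^sup>2))) \<longlonglongrightarrow> 0"
      using Lim_transform_eventually by fastforce
    from local_limit[OF tilt_lim tilt_ev_pos b1 b2 this] show ?thesis by blast
  qed
  show "local_const > 0" using lltl[of 1] by simp
  have lim: "(\<lambda>n. step_fun n X (m n) z) \<longlonglongrightarrow> local_const * \<tau> * (indicator {X..} z * exp (- z\<^sup>2))" if zX: "z \<noteq> X" for z
  proof (cases "z > 0")
    case False
    have "\<forall>\<^sub>F n in sequentially. step_fun n X (m n) z = 0"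
      using eventually_gt_at_top[of 0] by eventually_elim (use False step_fun_nonpos in auto)
    moreover have "indicator {X..} z = (0::real)" using False X zX by (auto simp: indicator_def)
    ultimately show ?thesis by (simp add: tendsto_eventually)
  next
    case z: True
    note jf = index_facts[OF z jz[OF z]]
    have st: "\<forall>\<^sub>F n in sequentially. step_fun n X (m n) z = step_height n X (m n) (j z n)"
      using c1[OF z] eventually_gt_at_top[of 0] jf(4)
    proof eventually_elim
      case (elim n)
      have "real (n mod 2) \<le> 1" by (cases "even n") (auto simp: odd_iff_mod_2_eq_one)
      moreover have "n mod 2 + 2 * k \<le> n \<Longrightarrow> k \<le> n div 2" for k by presburger
      from this[OF elim(3)[unfolded j_def]]
      have "nat \<lfloor>(index_of (tilt n) z - real (n mod 2)) / 2\<rfloor> \<le> n div 2" .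
      ultimately show ?case unfolding step_fun_eq[OF elim(2) z] using elim by (simp add: j_def)
    qed
    show ?thesis
    proof (cases "z > X")
      case True
      have "\<forall>\<^sub>F n in sequentially. tail_prod (tilt n) n (j z n) * tail_prod (tilt n) n (m n) * local_prob (tilt n) (j z n) (m n) ((n - j z n) div 2) = step_fun n X (m n) z"
        using st jz[OF z] by eventually_elim (use True in \<open>simp add: step_height_def\<close>)
      moreover have "(\<lambda>n. tail_prod (tilt n) n (j z n) * tail_prod (tilt n) n (m n) * local_prob (tilt n) (j z n) (m n) ((n - j z n) div 2)) \<longlonglongrightarrow> exp (- (z\<^sup>2)) * \<tau> * local_const"
        using lltl[OF z] by (intro tendsto_mult tail_prod_limit[OF jf(1) jf(4)] \<tau>) auto
      ultimately have "(\<lambda>n. step_fun n X (m n) z) \<longlonglongrightarrow> exp (- (z\<^sup>2)) * \<tau> * local_const" using Lim_transform_eventually by fastforce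
      then show ?thesis using True by (simp add: mult_ac)
    next
      case False
      then have zl: "z < X" using zX by simp
      have "\<forall>\<^sub>F n in sequentially. rpos (tilt n) (j z n) < X" by (rule order_tendstoD(2)[OF jf(1) zl])
      then have "\<forall>\<^sub>F n in sequentially. step_fun n X (m n) z = 0"
        using st by eventually_elim (simp add: step_height_def)
      then show ?thesis using zl by (simp add: tendsto_eventually)
    qed
  qed
  have lb: "local_bound \<ge> 0" using local_prob_le_bound[of "1/2" 2 0 0] by simp
  have Bs: "(\<lambda>n. B * tilt n) \<longlonglongrightarrow> 0" using tendsto_mult_right_zero[OF tilt_lim] by simp
  have "\<forall>\<^sub>F n in sequentially. B * tilt n < exp (- 1)" by (rule order_tendstoD(2)[OF Bs]) simp
  moreover have "\<forall>\<^sub>F n in sequentially. tilt n < 1/2" by (rule order_tendstoD(2)[OF tilt_lim]) simp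
  ultimately have bound: "\<forall>\<^sub>F n in sequentially. \<forall>z. norm (step_fun n X (m n) z) \<le> (4 * local_bound) / (1 + z\<^sup>2)"
    using B eventually_gt_at_top[of 0]
  proof eventually_elim
    case (elim n)
    have s: "tilt n > 0" by (rule tilt_pos[OF elim(4)])
    have "exp (- tilt n * real (m n)) < exp (- 1)" using elim by linarith
    then have "1 < tilt n * real (m n)" by simp
    then have sm: "1 / tilt n \<le> real (m n)" using s by (simp add: field_simps)
    have en: "exp (- tilt n * real n) / tilt n \<le> 1" using exp_tilt_n(2)[OF elim(4)] elim(2) by linarith
    show ?case
    proof
      fix z :: real
      have nn: "0 \<le> (4 * local_bound) / (1 + z\<^sup>2)" using lb by (auto intro!: divide_nonneg_nonneg add_nonneg_nonneg)
      show "norm (step_fun n X (m n) z) \<le> (4 * local_bound) / (1 + z\<^sup>2)"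
      proof (cases "z > 0")
        case False
        then show ?thesis using step_fun_nonpos[OF elim(4)] nn by simp
      next
        case z: True
        define i where "i = nat \<lfloor>(index_of (tilt n) z - real (n mod 2)) / 2\<rfloor>"
        show ?thesis
        proof (cases "real (n mod 2) \<le> index_of (tilt n) z \<and> i \<le> n div 2")
          case False
          then show ?thesis using nn unfolding step_fun_eq[OF elim(4) z] i_def[symmetric] by auto
        next
          case True
          let ?j = "n mod 2 + 2 * i"
          have "k \<le> n div 2 \<Longrightarrow> n mod 2 + 2 * k \<le> n" for k by presburger
          then have jn: "?j \<le> n" using True by blast
          have "real i \<le> (index_of (tilt n) z - real (n mod 2)) / 2"
            using True unfolding i_def by (intro of_nat_floor) simp
          then have "real ?j \<le> index_of (tilt n) z" by simp
          then have zj: "z \<le> rpos (tilt n) ?j" unfolding index_of_def rpos_ge_iff[OF s z] .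
          then have zj2: "z\<^sup>2 \<le> (rpos (tilt n) ?j)\<^sup>2" using z by (intro power_mono) auto
          have "tail_prod (tilt n) n ?j \<le> 2 * exp (- ((rpos (tilt n) ?j)\<^sup>2 / 2))"
            using s elim(2) en jn by (intro tail_prod_le_gauss) auto
          also have "\<dots> \<le> 2 * exp (- (z\<^sup>2 / 2))" using zj2 by simp
          also have "\<dots> \<le> 4 / (1 + z\<^sup>2)" using gauss_le_cauchy[of z] by simp
          finally have t: "tail_prod (tilt n) n ?j \<le> 4 / (1 + z\<^sup>2)" .
          have "\<bar>step_height n X (m n) ?j\<bar> \<le> tail_prod (tilt n) n ?j * tail_prod (tilt n) n (m n) * \<bar>local_prob (tilt n) ?j (m n) ((n - ?j) div 2)\<bar>"
            using tail_prod_nonneg[OF s] by (auto simp: step_height_def abs_mult)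
          also have "\<dots> \<le> (4 / (1 + z\<^sup>2)) * 1 * local_bound"
            using t tail_prod_nonneg[OF s] tail_prod_le_1[OF s] lb s elim(2) sm
            by (intro mult_mono local_prob_le_bound) (auto intro!: divide_nonneg_nonneg add_nonneg_nonneg)
          finally show ?thesis using True unfolding step_fun_eq[OF elim(4) z] i_def[symmetric] by simp
        qed
      qed
    qed
  qed
  have "AE z in lborel. (\<lambda>n. step_fun n X (m n) z) \<longlonglongrightarrow> local_const * \<tau> * (indicator {X..} z * exp (- z\<^sup>2))"
    using AE_lborel_singleton[of X] by eventually_elim (use lim in auto)
  from dominated_convergence_eventually(2)[OF _ _ integrable_cauchy this bound]
  have "(\<lambda>n. integral\<^sup>L lborel (step_fun n X (m n))) \<longlonglongrightarrow> (\<integral>z. local_const * \<tau> * (indicator {X..} z * exp (- z\<^sup>2)) \<partial>lborel)"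
    by simp
  then show "(\<lambda>n. integral\<^sup>L lborel (step_fun n X (m n))) \<longlonglongrightarrow> local_const * \<tau> * (\<integral>z. indicator {X..} z * exp (- z\<^sup>2) \<partial>lborel)"
    by simp
qed

theorem theorem8p1:
  fixes x y :: real
  shows "(\<lambda>n. measure_pmf.prob (M_uni n)
            {lam \<in> partitions n.
               pi / sqrt (6 * real n) * real (odd_parts lam) - alpha n \<le> x \<and>
               pi / sqrt (6 * real n) * real (even_parts lam) - alpha n \<le> y})
         \<longlonglongrightarrow> Erfc (exp (- x)) * exp (- exp (- 2 * y))"
proof -
  define X where "X = exp (- x)"
  define Y where "Y = exp (- y)"
  have XY: "X > 0" "Y > 0" by (auto simp: X_def Y_def)
  define m where "m = (\<lambda>n. nat \<lfloor>index_of (tilt n) Y\<rfloor>)"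
  have cY: "\<forall>\<^sub>F n in sequentially. 1 \<le> index_of (tilt n) Y"
    using rpos_1_ge[OF XY(2)] tilt_ev_pos
  proof eventually_elim
    case (elim n)
    then show ?case using rpos_ge_iff[OF elim(2) XY(2), of 1] by (simp add: index_of_def)
  qed
  have "\<forall>\<^sub>F n in sequentially. Y \<le> rpos (tilt n) (m n) \<and> rpos (tilt n) (m n) \<le> Y * exp (tilt n)"
    using cY tilt_ev_pos
  proof eventually_elim
    case (elim n)
    have "real (m n) \<le> index_of (tilt n) Y" "index_of (tilt n) Y < real (Suc (m n))" using elim unfolding m_def by linarith+
    then have 1: "Y \<le> rpos (tilt n) (m n)" "rpos (tilt n) (Suc (m n)) < Y"
      unfolding index_of_def rpos_ge_iff[OF elim(2) XY(2)] rpos_less_iff[OF elim(2) XY(2)] by auto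
    have "rpos (tilt n) (m n) = rpos (tilt n) (Suc (m n)) * exp (tilt n / 2)"
      unfolding rpos_Suc by (simp add: mult.assoc flip: exp_add)
    also have "\<dots> \<le> Y * exp (tilt n)" using 1 elim rpos_pos[of "tilt n" "Suc (m n)"] by (intro mult_mono) auto
    finally show ?case using 1 by simp
  qed
  note mf = index_facts[OF XY(2) this]
  have tau: "(\<lambda>n. tail_prod (tilt n) n (m n)) \<longlonglongrightarrow> exp (- (Y\<^sup>2))" by (rule tail_prod_limit[OF mf(1) mf(4)])
  note num = step_fun_limit(2)[OF mf(4) mf(2) tau less_imp_le[OF XY(1)]]
  have "\<forall>\<^sub>F n in sequentially. exp (- tilt n * real n) \<le> 1 * tilt n"
    using eventually_gt_at_top[of 0] by eventually_elim (use exp_tilt_n in simp)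
  \<comment> \<open>The total count is the case \<open>X = 0\<close>, \<open>m n = n\<close>, where the tail product is empty.\<close>
  note den = step_fun_limit[OF _ this, of 1 0, simplified tail_prod_def, simplified]
  have K: "local_const > 0" by (rule den(1))
  have gi: "(\<integral>z. indicator {0..} z * exp (- z\<^sup>2) \<partial>lborel) = sqrt pi / 2"
    using gaussian_moment_0 by (simp add: has_bochner_integral_iff)
  have "(\<lambda>n. integral\<^sup>L lborel (step_fun n X (m n)) / integral\<^sup>L lborel (step_fun n 0 n)) \<longlonglongrightarrow>
      (local_const * exp (- (Y\<^sup>2)) * (\<integral>z. indicator {X..} z * exp (- z\<^sup>2) \<partial>lborel)) / (local_const * (sqrt pi / 2))"
    using K den(2) unfolding gi by (intro tendsto_divide num) auto
  also have "(local_const * exp (- (Y\<^sup>2)) * (\<integral>z. indicator {X..} z * exp (- z\<^sup>2) \<partial>lborel)) / (local_const * (sqrt pi / 2)) = Erfc (exp (- x)) * exp (- exp (- 2 * y))"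
  proof -
    have "Y\<^sup>2 = exp (- 2 * y)" by (simp add: Y_def power2_eq_square flip: exp_add)
    then show ?thesis using K by (simp add: Erfc_def set_lebesgue_integral_def X_def)
  qed
  finally have lim: "(\<lambda>n. integral\<^sup>L lborel (step_fun n X (m n)) / integral\<^sup>L lborel (step_fun n 0 n)) \<longlonglongrightarrow> Erfc (exp (- x)) * exp (- exp (- 2 * y))" .
  have "\<forall>\<^sub>F n in sequentially. integral\<^sup>L lborel (step_fun n X (m n)) / integral\<^sup>L lborel (step_fun n 0 n) =
     measure_pmf.prob (M_uni n)
            {lam \<in> partitions n.
               pi / sqrt (6 * real n) * real (odd_parts lam) - alpha n \<le> x \<and>
               pi / sqrt (6 * real n) * real (even_parts lam) - alpha n \<le> y}"
    using eventually_gt_at_top[of 0] cY mf(4)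
  proof eventually_elim
    case (elim n)
    let ?A = "{lam \<in> partitions n. pi / sqrt (6 * real n) * real (odd_parts lam) - alpha n \<le> x \<and>
               pi / sqrt (6 * real n) * real (even_parts lam) - alpha n \<le> y}"
    have s: "tilt n > 0" by (rule tilt_pos[OF elim(1)])
    have s2: "pi / sqrt (6 * real n) = tilt n / 2" by (simp add: tilt_def)
    have iff: "tilt n / 2 * real l - alpha n \<le> t \<longleftrightarrow> real l \<le> index_of (tilt n) (exp (- t))" for l t
    proof -
      have "real l \<le> 2 / tilt n * (- ln (tilt n) / 2 + t) \<longleftrightarrow> tilt n * real l \<le> 2 * (- ln (tilt n) / 2 + t)"
        using s by (simp add: pos_le_divide_eq mult.commute)
      moreover have "a / 2 - (- b / 2) \<le> t \<longleftrightarrow> a \<le> 2 * (- b / 2 + t)" for a b :: real by auto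
      ultimately show ?thesis unfolding alpha_eq[OF elim(1)] index_of_def by simp
    qed
    have o: "pi / sqrt (6 * real n) * real l - alpha n \<le> x \<longleftrightarrow> X \<le> rpos (tilt n) l" for l
      unfolding s2 iff X_def rpos_ge_iff[OF s exp_gt_zero] index_of_def ..
    have e: "pi / sqrt (6 * real n) * real l - alpha n \<le> y \<longleftrightarrow> l \<le> m n" for l
      unfolding s2 iff m_def Y_def[symmetric] using elim(2) by (simp add: le_nat_floor le_nat_iff le_floor_iff)
    have A: "?A = {lam \<in> partitions n. X \<le> rpos (tilt n) (odd_parts lam) \<and> even_parts lam \<le> m n}"
      unfolding o e ..
    have P: "partitions n = {lam \<in> partitions n. 0 \<le> rpos (tilt n) (odd_parts lam) \<and> even_parts lam \<le> n}"
      using odd_even_parts_le rpos_pos[OF s] by (auto intro: less_imp_le)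
    have "measure_pmf.prob (M_uni n) ?A = real (card (partitions n \<inter> ?A)) / real (card (partitions n))"
      unfolding M_uni_def by (rule measure_pmf_of_set[OF partitions_nonempty finite_partitions])
    also have "partitions n \<inter> ?A = ?A" by blast
    also have "real (card ?A) = common_weight n * integral\<^sup>L lborel (step_fun n X (m n))"
      unfolding A by (rule card_eq_integral[OF elim(1,3)])
    also have "real (card (partitions n)) = common_weight n * integral\<^sup>L lborel (step_fun n 0 n)"
      by (subst P, rule card_eq_integral[OF elim(1) order_refl])
    finally show ?case using common_weight_pos[OF elim(1)] by simp
  qed
  from Lim_transform_eventually[OF lim this] show ?thesis .
qed

end
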